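(* Let $G_0$ be a group acting decently on a set $X_0$ with basepoint $x_0$. Let $H$ be a group acting on a set $P$, and let $\Gamma<G^{\oplus}$ be a finitely generated subgroup acting purely elliptically on $X=X_0^{\oplus P}$. If $\mathrm{proj}_H(\Gamma)$ is virtually nilpotent, then $\Gamma$ fixes a point of $X$.
   Context: **Decent action.** An action of a group $G$ on a set $Y$ is *purely elliptic* if every element of $G$ fixes a point of $Y$. An action of $G$ on $Y$ is *decent* if: (1) every subgroup of $G$ with a finite orbit on $Y$ fixes a point of $Y$; and (2) every finitely generated subgroup of $G$ acting purely elliptically on $Y$ fixes a point of $Y$. **Restricted product.** $X=X_0^{\oplus P}$ is the set of all $(y_p)_p\in\prod_{p\in P}X_0$ such that $y_p=x_0$ for all but finitely many $p\in P$. **The group $G^{\oplus}$.** Given actions of $H$ on $P$ and of $G_0$ on $X_0$, the unrestricted wreath product $G_0\wr_P H=\prod_P G_0\rtimes H$ acts on $\prod_P X_0$ by $(ghx)_p=g_p\,x_{h^{-1}p}$ for $g\in\prod_P G_0$, $h\in H$, $x=(x_p)_p\in\prod_P X_0$. $G^{\oplus}$ denotes the subgroup of $G_0\wr_P H$ preserving $X$. For $\Gamma<G_0\wr_P H$, $\mathrm{proj}_H(\Gamma)$ is the image of $\Gamma$ under the projection homomorphism $\prod_P G_0\rtimes H\to H$. *)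

theory Defs
  imports "HOL-Algebra.Algebra"
begin

section \<open>Finitely generated and virtually nilpotent groups\<close>

text \<open>A subgroup \<open>K\<close> of \<open>G\<close>, viewed as a group, is \<open>G\<lparr>carrier := K\<rparr>\<close>, as in HOL-Algebra.\<close>

definition finitely_generated :: "('g, 'm) monoid_scheme \<Rightarrow> bool" where
  "finitely_generated G \<longleftrightarrow> (\<exists>S. finite S \<and> S \<subseteq> carrier G \<and> generate G S = carrier G)"

primrec lower_central :: "('g, 'm) monoid_scheme \<Rightarrow> nat \<Rightarrow> 'g set" where
  "lower_central G 0 = carrier G"
| "lower_central G (Suc n) =
     generate G (\<Union>x \<in> lower_central G n. \<Union>y \<in> carrier G.
       {x \<otimes>\<^bsub>G\<^esub> y \<otimes>\<^bsub>G\<^esub> inv\<^bsub>G\<^esub> x \<otimes>\<^bsub>G\<^esub> inv\<^bsub>G\<^esub> y})"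

definition nilpotent_group :: "('g, 'm) monoid_scheme \<Rightarrow> bool" where
  "nilpotent_group G \<longleftrightarrow> group G \<and> (\<exists>n. lower_central G n = {\<one>\<^bsub>G\<^esub>})"

definition virtually_nilpotent :: "('g, 'm) monoid_scheme \<Rightarrow> bool" where
  "virtually_nilpotent G \<longleftrightarrow>
     group G \<and> (\<exists>N. subgroup N G \<and> finite (rcosets\<^bsub>G\<^esub> N) \<and> nilpotent_group (G\<lparr>carrier := N\<rparr>))"


section \<open>Decent actions\<close>

definition fixes_point :: "('g, 'm) monoid_scheme \<Rightarrow> 'y set \<Rightarrow> ('g \<Rightarrow> 'y \<Rightarrow> 'y) \<Rightarrow> bool" where
  "fixes_point G Y \<phi> \<longleftrightarrow> (\<exists>y\<in>Y. \<forall>g\<in>carrier G. \<phi> g y = y)"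

definition purely_elliptic :: "('g, 'm) monoid_scheme \<Rightarrow> 'y set \<Rightarrow> ('g \<Rightarrow> 'y \<Rightarrow> 'y) \<Rightarrow> bool" where
  "purely_elliptic G Y \<phi> \<longleftrightarrow> (\<forall>g\<in>carrier G. \<exists>y\<in>Y. \<phi> g y = y)"

definition decent_action :: "('g, 'm) monoid_scheme \<Rightarrow> 'y set \<Rightarrow> ('g \<Rightarrow> 'y \<Rightarrow> 'y) \<Rightarrow> bool" where
  "decent_action G Y \<phi> \<longleftrightarrow>
     group_action G Y \<phi> \<and>
     (\<forall>K. subgroup K G \<and> (\<exists>y\<in>Y. finite (orbit (G\<lparr>carrier := K\<rparr>) \<phi> y))
        \<longrightarrow> fixes_point (G\<lparr>carrier := K\<rparr>) Y \<phi>) \<and>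
     (\<forall>K. subgroup K G \<and> finitely_generated (G\<lparr>carrier := K\<rparr>)
          \<and> purely_elliptic (G\<lparr>carrier := K\<rparr>) Y \<phi>
        \<longrightarrow> fixes_point (G\<lparr>carrier := K\<rparr>) Y \<phi>)"


section \<open>Wreath products and their action\<close>

text \<open>The coordinate permutation \<open>(h x)\<^sub>p = x\<^bsub>h\<inverse>p\<^esub>\<close> induced by an action \<open>\<psi>\<close> of \<open>H\<close> on \<open>P\<close>;
  it is used both on families of group elements and on families of points.\<close>

definition shift :: "('h, 'm) monoid_scheme \<Rightarrow> 'p set \<Rightarrow> ('h \<Rightarrow> 'p \<Rightarrow> 'p) \<Rightarrow> 'h \<Rightarrow> ('p \<Rightarrow> 'z) \<Rightarrow> 'p \<Rightarrow> 'z"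
  where "shift H P \<psi> h x = (\<lambda>p\<in>P. x (\<psi> (inv\<^bsub>H\<^esub> h) p))"

text \<open>The unrestricted wreath product; the pair \<open>(g, h)\<close> is the element \<open>g h\<close> of
  the semidirect product, in which \<open>h g h\<inverse> = shift H P \<psi> h g\<close>.\<close>

definition wreath_product ::
  "('g, 'm) monoid_scheme \<Rightarrow> ('h, 'n) monoid_scheme \<Rightarrow> 'p set \<Rightarrow> ('h \<Rightarrow> 'p \<Rightarrow> 'p)
     \<Rightarrow> (('p \<Rightarrow> 'g) \<times> 'h) monoid" where
  "wreath_product G H P \<psi> =
     \<lparr>carrier = carrier (product_group P (\<lambda>_. G)) \<times> carrier H,
      monoid.mult = (\<lambda>(g, h) (g', h').
        (g \<otimes>\<^bsub>product_group P (\<lambda>_. G)\<^esub> shift H P \<psi> h g', h \<otimes>\<^bsub>H\<^esub> h')),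
      one = (\<one>\<^bsub>product_group P (\<lambda>_. G)\<^esub>, \<one>\<^bsub>H\<^esub>)\<rparr>"

definition wreath_action ::
  "('h, 'n) monoid_scheme \<Rightarrow> 'p set \<Rightarrow> ('h \<Rightarrow> 'p \<Rightarrow> 'p) \<Rightarrow> 'x set \<Rightarrow> ('g \<Rightarrow> 'x \<Rightarrow> 'x)
     \<Rightarrow> ('p \<Rightarrow> 'g) \<times> 'h \<Rightarrow> ('p \<Rightarrow> 'x) \<Rightarrow> 'p \<Rightarrow> 'x" where
  "wreath_action H P \<psi> Y \<phi> =
     (\<lambda>(g, h). \<lambda>x \<in> (\<Pi>\<^sub>E p\<in>P. Y). \<lambda>p\<in>P. \<phi> (g p) (shift H P \<psi> h x p))"

definition restricted_power :: "'p set \<Rightarrow> 'x set \<Rightarrow> 'x \<Rightarrow> ('p \<Rightarrow> 'x) set" where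
  "restricted_power P Y x\<^sub>0 = {y \<in> (\<Pi>\<^sub>E p\<in>P. Y). finite {p \<in> P. y p \<noteq> x\<^sub>0}}"

definition G_oplus ::
  "('g, 'm) monoid_scheme \<Rightarrow> ('h, 'n) monoid_scheme \<Rightarrow> 'p set \<Rightarrow> ('h \<Rightarrow> 'p \<Rightarrow> 'p)
     \<Rightarrow> 'x set \<Rightarrow> ('g \<Rightarrow> 'x \<Rightarrow> 'x) \<Rightarrow> 'x \<Rightarrow> (('p \<Rightarrow> 'g) \<times> 'h) monoid" where
  "G_oplus G H P \<psi> Y \<phi> x\<^sub>0 = (wreath_product G H P \<psi>)
     \<lparr>carrier := {\<gamma> \<in> carrier (wreath_product G H P \<psi>).
        wreath_action H P \<psi> Y \<phi> \<gamma> ` restricted_power P Y x\<^sub>0 = restricted_power P Y x\<^sub>0}\<rparr>"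

definition G_oplus_action ::
  "('h, 'n) monoid_scheme \<Rightarrow> 'p set \<Rightarrow> ('h \<Rightarrow> 'p \<Rightarrow> 'p) \<Rightarrow> 'x set \<Rightarrow> ('g \<Rightarrow> 'x \<Rightarrow> 'x) \<Rightarrow> 'x
     \<Rightarrow> ('p \<Rightarrow> 'g) \<times> 'h \<Rightarrow> ('p \<Rightarrow> 'x) \<Rightarrow> 'p \<Rightarrow> 'x" where
  "G_oplus_action H P \<psi> Y \<phi> x\<^sub>0 \<gamma> =
     restrict (wreath_action H P \<psi> Y \<phi> \<gamma>) (restricted_power P Y x\<^sub>0)"


section \<open>Well-definedness\<close>

lemma group_action_comp:
  assumes "group_action G Y \<phi>" "g \<in> carrier G" "h \<in> carrier G" "y \<in> Y"
  shows "\<phi> (g \<otimes>\<^bsub>G\<^esub> h) y = \<phi> g (\<phi> h y)"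
  using group_action.composition_rule[OF assms(1) assms(4) assms(2) assms(3)] by simp

lemma group_action_group: "group_action G Y \<phi> \<Longrightarrow> group G"
  by (simp add: group_action_def group_hom_def)

lemma group_action_one:
  assumes "group_action G Y \<phi>" "y \<in> Y" shows "\<phi> \<one>\<^bsub>G\<^esub> y = y"
  using group_action.id_eq_one[OF assms(1)] assms(2) by (metis restrict_apply')

lemma group_action_closed:
  assumes "group_action G Y \<phi>" "g \<in> carrier G" "y \<in> Y" shows "\<phi> g y \<in> Y"
  using group_action.element_image[OF assms(1,2,3)] by blast

lemma group_actionI:
  assumes G: "group G"
    and ext: "\<And>g. g \<in> carrier G \<Longrightarrow> \<phi> g \<in> extensional Y"
    and cl: "\<And>g y. g \<in> carrier G \<Longrightarrow> y \<in> Y \<Longrightarrow> \<phi> g y \<in> Y"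
    and one: "\<And>y. y \<in> Y \<Longrightarrow> \<phi> \<one>\<^bsub>G\<^esub> y = y"
    and mult: "\<And>g h y. g \<in> carrier G \<Longrightarrow> h \<in> carrier G \<Longrightarrow> y \<in> Y \<Longrightarrow>
                 \<phi> (g \<otimes>\<^bsub>G\<^esub> h) y = \<phi> g (\<phi> h y)"
  shows "group_action G Y \<phi>"
proof -
  interpret group G by (rule G)
  have bij: "\<phi> g \<in> Bij Y" if g: "g \<in> carrier G" for g
  proof -
    have "bij_betw (\<phi> g) Y Y"
    proof (rule bij_betwI[where g = "\<phi> (inv\<^bsub>G\<^esub> g)"])
      show "\<phi> (inv\<^bsub>G\<^esub> g) (\<phi> g y) = y" if "y \<in> Y" for y
        using that g mult[of "inv\<^bsub>G\<^esub> g" g y] one by simp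
      show "\<phi> g (\<phi> (inv\<^bsub>G\<^esub> g) y) = y" if "y \<in> Y" for y
        using that g mult[of g "inv\<^bsub>G\<^esub> g" y] one by simp
    qed (use g cl in auto)
    then show ?thesis using ext g by (simp add: Bij_def)
  qed
  have "\<phi> \<in> hom G (BijGroup Y)"
  proof (rule homI)
    fix g h assume gh: "g \<in> carrier G" "h \<in> carrier G"
    have "\<phi> (g \<otimes>\<^bsub>G\<^esub> h) = compose Y (\<phi> g) (\<phi> h)"
      by (rule extensionalityI[of _ Y]) (use gh ext mult in \<open>auto simp: compose_def\<close>)
    then show "\<phi> (g \<otimes>\<^bsub>G\<^esub> h) = \<phi> g \<otimes>\<^bsub>BijGroup Y\<^esub> \<phi> h"
      using gh bij by (simp add: BijGroup_def)
  qed (simp add: BijGroup_def bij)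
  then show ?thesis
    unfolding group_action_def group_hom_def group_hom_axioms_def
    using G group_BijGroup by blast
qed

lemma shift_PiE:
  assumes "group_action H P \<psi>" "h \<in> carrier H" "x \<in> (\<Pi>\<^sub>E p\<in>P. A)"
  shows "shift H P \<psi> h x \<in> (\<Pi>\<^sub>E p\<in>P. A)"
  using assms group_action_closed[OF assms(1)] group.inv_closed[OF group_action_group[OF assms(1)]]
  unfolding shift_def by (auto simp: PiE_iff)

lemma shift_mult:
  assumes "group_action H P \<psi>" "h \<in> carrier H" "k \<in> carrier H"
  shows "shift H P \<psi> (h \<otimes>\<^bsub>H\<^esub> k) x = shift H P \<psi> h (shift H P \<psi> k x)"
proof -
  interpret H: group H by (rule group_action_group[OF assms(1)])
  show ?thesis
    unfolding shift_def using assms(2,3)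
    by (intro restrict_ext)
      (simp add: H.inv_mult_group group_action_comp[OF assms(1)] group_action_closed[OF assms(1)])
qed

lemma shift_one:
  assumes "group_action H P \<psi>" "x \<in> extensional P"
  shows "shift H P \<psi> \<one>\<^bsub>H\<^esub> x = x"
proof -
  interpret H: group H by (rule group_action_group[OF assms(1)])
  show ?thesis
    unfolding shift_def
    by (rule extensionalityI[of _ P]) (use assms in \<open>auto simp: group_action_one[OF assms(1)]\<close>)
qed

lemma shift_product_mult:
  assumes "group_action H P \<psi>" "h \<in> carrier H"
  shows "shift H P \<psi> h (\<lambda>p\<in>P. f p \<otimes>\<^bsub>G\<^esub> g p)
    = (\<lambda>p\<in>P. shift H P \<psi> h f p \<otimes>\<^bsub>G\<^esub> shift H P \<psi> h g p)"
  unfolding shift_def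
  using assms(2) group_action_closed[OF assms(1)] group.inv_closed[OF group_action_group[OF assms(1)]]
  by (auto intro!: restrict_ext)

lemma wreath_product_carrier:
  "(g, h) \<in> carrier (wreath_product G H P \<psi>) \<longleftrightarrow>
     g \<in> carrier (product_group P (\<lambda>_. G)) \<and> h \<in> carrier H"
  by (simp add: wreath_product_def)

lemma wreath_product_mult:
  "(g, h) \<otimes>\<^bsub>wreath_product G H P \<psi>\<^esub> (g', h') =
     (g \<otimes>\<^bsub>product_group P (\<lambda>_. G)\<^esub> shift H P \<psi> h g', h \<otimes>\<^bsub>H\<^esub> h')"
  by (simp add: wreath_product_def)

lemma wreath_product_one:
  "\<one>\<^bsub>wreath_product G H P \<psi>\<^esub> = (\<one>\<^bsub>product_group P (\<lambda>_. G)\<^esub>, \<one>\<^bsub>H\<^esub>)"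
  by (simp add: wreath_product_def)

lemma group_wreath_product:
  assumes G: "group G" and act: "group_action H P \<psi>"
  shows "group (wreath_product G H P \<psi>)"
proof -
  let ?W = "wreath_product G H P \<psi>" and ?N = "product_group P (\<lambda>_. G)"
  interpret H: group H by (rule group_action_group[OF act])
  interpret N: group ?N using G by simp
  have sh: "shift H P \<psi> h x \<in> carrier ?N" if "h \<in> carrier H" "x \<in> carrier ?N" for h x
    using shift_PiE[OF act that(1), of x "carrier G"] that(2) by simp
  have sm: "shift H P \<psi> h (x \<otimes>\<^bsub>?N\<^esub> y) = shift H P \<psi> h x \<otimes>\<^bsub>?N\<^esub> shift H P \<psi> h y"
    if "h \<in> carrier H" for h x y
    using shift_product_mult[OF act that] by simp
  have s1: "shift H P \<psi> \<one>\<^bsub>H\<^esub> x = x" if "x \<in> carrier ?N" for x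
    by (rule shift_one[OF act]) (use that in \<open>simp add: PiE_iff\<close>)
  note W = wreath_product_carrier wreath_product_mult wreath_product_one
  note [simp del] = carrier_product_group mult_product_group one_product_group inv_product_group
  show ?thesis
  proof (rule groupI)
    fix a b assume ab: "a \<in> carrier ?W" "b \<in> carrier ?W"
    obtain f h where a: "a = (f, h)" by (cases a)
    obtain g k where b: "b = (g, k)" by (cases b)
    show "a \<otimes>\<^bsub>?W\<^esub> b \<in> carrier ?W"
      using ab by (simp add: a b W sh)
  next
    show "\<one>\<^bsub>?W\<^esub> \<in> carrier ?W"
      by (simp add: W)
  next
    fix a b c assume abc: "a \<in> carrier ?W" "b \<in> carrier ?W" "c \<in> carrier ?W"
    obtain f h where a: "a = (f, h)" by (cases a)
    obtain g k where b: "b = (g, k)" by (cases b)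
    obtain e l where c: "c = (e, l)" by (cases c)
    show "a \<otimes>\<^bsub>?W\<^esub> b \<otimes>\<^bsub>?W\<^esub> c = a \<otimes>\<^bsub>?W\<^esub> (b \<otimes>\<^bsub>?W\<^esub> c)"
      using abc by (simp add: a b c W sh sm shift_mult[OF act] H.m_assoc N.m_assoc)
  next
    fix a assume am: "a \<in> carrier ?W"
    obtain f h where a: "a = (f, h)" by (cases a)
    show "\<one>\<^bsub>?W\<^esub> \<otimes>\<^bsub>?W\<^esub> a = a"
      using am by (simp add: a W s1)
    define s where "s = shift H P \<psi> (inv\<^bsub>H\<^esub> h) f"
    have s: "s \<in> carrier ?N" "h \<in> carrier H"
      using am by (simp_all add: a W sh s_def)
    have "(inv\<^bsub>?N\<^esub> s, inv\<^bsub>H\<^esub> h) \<otimes>\<^bsub>?W\<^esub> a = \<one>\<^bsub>?W\<^esub>"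
      using s by (simp add: a W flip: s_def)
    moreover have "(inv\<^bsub>?N\<^esub> s, inv\<^bsub>H\<^esub> h) \<in> carrier ?W"
      using s by (simp add: W)
    ultimately show "\<exists>b\<in>carrier ?W. b \<otimes>\<^bsub>?W\<^esub> a = \<one>\<^bsub>?W\<^esub>"
      by (rule rev_bexI[rotated])
  qed
qed

lemma snd_wreath_product_hom: "snd \<in> hom (wreath_product G H P \<psi>) H"
  by (auto simp: hom_def wreath_product_def)

lemma wreath_action_apply:
  assumes "x \<in> (\<Pi>\<^sub>E p\<in>P. Y)" "p \<in> P"
  shows "wreath_action H P \<psi> Y \<phi> (g, h) x p = \<phi> (g p) (x (\<psi> (inv\<^bsub>H\<^esub> h) p))"
  using assms by (simp add: wreath_action_def shift_def)

lemma wreath_action_group_action: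
  assumes actG: "group_action G Y \<phi>" and act: "group_action H P \<psi>"
  shows "group_action (wreath_product G H P \<psi>) (\<Pi>\<^sub>E p\<in>P. Y) (wreath_action H P \<psi> Y \<phi>)"
proof (rule group_actionI)
  interpret G: group G by (rule group_action_group[OF actG])
  interpret H: group H by (rule group_action_group[OF act])
  let ?W = "wreath_product G H P \<psi>" and ?A = "wreath_action H P \<psi> Y \<phi>"
  show "group ?W"
    by (rule group_wreath_product[OF G.group_axioms act])
  show "?A g \<in> extensional (\<Pi>\<^sub>E p\<in>P. Y)" for g
    by (cases g) (simp add: wreath_action_def)
  have cl: "?A a x \<in> (\<Pi>\<^sub>E p\<in>P. Y)" if "a \<in> carrier ?W" "x \<in> (\<Pi>\<^sub>E p\<in>P. Y)" for a x
  proof (cases a)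
    case (Pair g h)
    then show ?thesis
      using that shift_PiE[OF act _ that(2), of h] group_action_closed[OF actG]
      by (auto simp: wreath_action_def wreath_product_def PiE_iff)
  qed
  then show "?A a x \<in> (\<Pi>\<^sub>E p\<in>P. Y)" if "a \<in> carrier ?W" "x \<in> (\<Pi>\<^sub>E p\<in>P. Y)" for a x
    using that by blast
  show "?A \<one>\<^bsub>?W\<^esub> x = x" if x: "x \<in> (\<Pi>\<^sub>E p\<in>P. Y)" for x
  proof (rule extensionalityI[of _ P])
    show "?A \<one>\<^bsub>?W\<^esub> x p = x p" if "p \<in> P" for p
      using that x group_action_one[OF actG] group_action_one[OF act]
      by (auto simp: wreath_product_def wreath_action_apply PiE_iff)
  qed (use x in \<open>auto simp: wreath_product_def wreath_action_def PiE_iff\<close>)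
  show "?A (a \<otimes>\<^bsub>?W\<^esub> b) x = ?A a (?A b x)"
    if a: "a \<in> carrier ?W" and b: "b \<in> carrier ?W" and x: "x \<in> (\<Pi>\<^sub>E p\<in>P. Y)" for a b x
  proof -
    obtain f h where a': "a = (f, h)" by (cases a)
    obtain g k where b': "b = (g, k)" by (cases b)
    have mem: "f \<in> (\<Pi>\<^sub>E p\<in>P. carrier G)" "g \<in> (\<Pi>\<^sub>E p\<in>P. carrier G)" "h \<in> carrier H" "k \<in> carrier H"
      using a b by (auto simp: a' b' wreath_product_def)
    have ax: "?A b x \<in> (\<Pi>\<^sub>E p\<in>P. Y)" by (rule cl[OF b x])
    show ?thesis
    proof (rule extensionalityI[of _ P])
      fix p assume p: "p \<in> P"
      have q: "\<psi> (inv\<^bsub>H\<^esub> h) p \<in> P" using group_action_closed[OF act] mem p by simp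
      have r: "\<psi> (inv\<^bsub>H\<^esub> k) (\<psi> (inv\<^bsub>H\<^esub> h) p) \<in> P" using group_action_closed[OF act] mem q by simp
      have xr: "x (\<psi> (inv\<^bsub>H\<^esub> k) (\<psi> (inv\<^bsub>H\<^esub> h) p)) \<in> Y" using x r by (auto simp: PiE_iff)
      have fp: "f p \<in> carrier G" "g (\<psi> (inv\<^bsub>H\<^esub> h) p) \<in> carrier G" using mem p q by auto
      show "?A (a \<otimes>\<^bsub>?W\<^esub> b) x p = ?A a (?A b x) p"
        using mem x p q r xr fp ax
        by (simp add: a' b' wreath_product_def wreath_action_apply shift_def H.inv_mult_group
            group_action_comp[OF act] group_action_comp[OF actG])
    next
      show "?A (a \<otimes>\<^bsub>?W\<^esub> b) x \<in> extensional P"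
        using x by (simp add: a' b' wreath_product_def wreath_action_def)
      show "?A a (?A b x) \<in> extensional P"
        using cl[OF a ax] by (simp add: PiE_iff)
    qed
  qed
qed

lemma G_oplus_subgroup:
  assumes actG: "group_action G Y \<phi>" and act: "group_action H P \<psi>"
  shows "subgroup (carrier (G_oplus G H P \<psi> Y \<phi> x\<^sub>0)) (wreath_product G H P \<psi>)"
proof -
  let ?W = "wreath_product G H P \<psi>" and ?A = "wreath_action H P \<psi> Y \<phi>"
  let ?Y = "restricted_power P Y x\<^sub>0"
  note wa = wreath_action_group_action[OF actG act]
  interpret W: group ?W by (rule group_action_group[OF wa])
  have sub: "?Y \<subseteq> (\<Pi>\<^sub>E p\<in>P. Y)" by (auto simp: restricted_power_def)
  have "?A \<one>\<^bsub>?W\<^esub> x = x" if "x \<in> ?Y" for x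
    using group_action_one[OF wa] sub that by blast
  then have one: "?A \<one>\<^bsub>?W\<^esub> ` ?Y = ?Y"
    by simp
  have mult: "?A (a \<otimes>\<^bsub>?W\<^esub> b) ` ?Y = ?A a ` (?A b ` ?Y)"
    if "a \<in> carrier ?W" "b \<in> carrier ?W" for a b
    unfolding image_image
    using group_action_comp[OF wa that] sub by (intro image_cong) blast+
  show ?thesis
  proof (rule W.subgroupI)
    fix a assume "a \<in> carrier (G_oplus G H P \<psi> Y \<phi> x\<^sub>0)"
    then have a: "a \<in> carrier ?W" "?A a ` ?Y = ?Y" by (auto simp: G_oplus_def)
    have "?A (inv\<^bsub>?W\<^esub> a) ` ?Y = ?Y"
      using mult[of "inv\<^bsub>?W\<^esub> a" a] a one by simp
    then show "inv\<^bsub>?W\<^esub> a \<in> carrier (G_oplus G H P \<psi> Y \<phi> x\<^sub>0)"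
      using a by (simp add: G_oplus_def)
  next
    have "\<one>\<^bsub>?W\<^esub> \<in> carrier (G_oplus G H P \<psi> Y \<phi> x\<^sub>0)"
      using one by (simp add: G_oplus_def)
    then show "carrier (G_oplus G H P \<psi> Y \<phi> x\<^sub>0) \<noteq> {}"
      by blast
  next
    show "carrier (G_oplus G H P \<psi> Y \<phi> x\<^sub>0) \<subseteq> carrier ?W"
      by (simp add: G_oplus_def)
  next
    fix a b assume "a \<in> carrier (G_oplus G H P \<psi> Y \<phi> x\<^sub>0)" "b \<in> carrier (G_oplus G H P \<psi> Y \<phi> x\<^sub>0)"
    then show "a \<otimes>\<^bsub>?W\<^esub> b \<in> carrier (G_oplus G H P \<psi> Y \<phi> x\<^sub>0)"
      by (simp add: G_oplus_def mult)
  qed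
qed

lemma G_oplus_group_action:
  assumes actG: "group_action G Y \<phi>" and act: "group_action H P \<psi>"
  shows "group_action (G_oplus G H P \<psi> Y \<phi> x\<^sub>0) (restricted_power P Y x\<^sub>0)
           (G_oplus_action H P \<psi> Y \<phi> x\<^sub>0)"
proof (rule group_actionI)
  let ?W = "wreath_product G H P \<psi>" and ?A = "wreath_action H P \<psi> Y \<phi>"
  let ?Y = "restricted_power P Y x\<^sub>0" and ?G = "G_oplus G H P \<psi> Y \<phi> x\<^sub>0"
  note wa = wreath_action_group_action[OF actG act]
  interpret W: group ?W by (rule group_action_group[OF wa])
  have sub: "?Y \<subseteq> (\<Pi>\<^sub>E p\<in>P. Y)" by (auto simp: restricted_power_def)
  show "group ?G"
    using subgroup.subgroup_is_group[OF G_oplus_subgroup[OF actG act] W.group_axioms]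
    by (simp add: G_oplus_def)
  show "G_oplus_action H P \<psi> Y \<phi> x\<^sub>0 g \<in> extensional ?Y" for g
    by (simp add: G_oplus_action_def)
  show cl: "G_oplus_action H P \<psi> Y \<phi> x\<^sub>0 g y \<in> ?Y" if "g \<in> carrier ?G" "y \<in> ?Y" for g y
  proof -
    have "?A g ` ?Y = ?Y" using that(1) by (simp add: G_oplus_def)
    then have "?A g y \<in> ?Y" using that(2) by blast
    then show ?thesis using that(2) by (simp add: G_oplus_action_def)
  qed
  show "G_oplus_action H P \<psi> Y \<phi> x\<^sub>0 \<one>\<^bsub>?G\<^esub> y = y" if "y \<in> ?Y" for y
    using group_action_one[OF wa subsetD[OF sub that]] that
    by (simp add: G_oplus_action_def G_oplus_def)
  show "G_oplus_action H P \<psi> Y \<phi> x\<^sub>0 (g \<otimes>\<^bsub>?G\<^esub> h) y =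
      G_oplus_action H P \<psi> Y \<phi> x\<^sub>0 g (G_oplus_action H P \<psi> Y \<phi> x\<^sub>0 h y)"
    if "g \<in> carrier ?G" "h \<in> carrier ?G" "y \<in> ?Y" for g h y
    using group_action_comp[OF wa, of g h y] cl[OF that(2,3)] that subsetD[OF sub that(3)]
    by (simp add: G_oplus_action_def G_oplus_def)
qed

end

theory Submission
  imports Defs
begin

text \<open>
  A point of \<open>\<Prod>\<^sub>P X\<^sub>0\<close> is a section of the trivial bundle \<open>P \<times> X\<^sub>0 \<rightarrow> P\<close>, on which the wreath product acts by bundle
  maps; a fixed point in the restricted product is an invariant section that equals \<open>x\<^sub>0\<close> almost everywhere. Every
  element of \<open>\<Gamma>\<close> preserves the constant section \<open>x\<^sub>0\<close> over all but finitely many points, and \<open>\<Gamma>\<close> is finitely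
  generated, so the constant section is invariant over all but finitely many \<open>\<Gamma>\<close>-orbits in \<open>P\<close>. It remains to
  find an invariant section of finite support over one orbit (\<open>glue_orbits\<close>).

  A subgroup of finite index may replace \<open>\<Gamma>\<close>. It is finitely generated by Schreier's lemma, and if it fixes a
  section, this section has finitely many translates under \<open>\<Gamma>\<close>, from which a \<open>\<Gamma>\<close>-invariant section can be made
  with the first condition of decency (\<open>invariant_section_if_finite_index\<close>). So \<open>\<Gamma>\<close> may be assumed to act on
  \<open>P\<close> through a nilpotent group.

  Over a finite orbit the stabilizer of a point is finitely generated and acts purely elliptically on the fibre. By
  the second condition of decency it fixes a point there, which spreads to an invariant section over the orbit.

  Over an infinite orbit \<open>O\<close> the image of \<open>\<Gamma>\<close> in the permutations of \<open>O\<close> is an infinite finitely generated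
  nilpotent group, so it has a central element of infinite order
  (\<open>nilpotent_central_element_infinite_order\<close>). A lift \<open>z \<in> \<Gamma>\<close> of it moves every point of \<open>O\<close> along an infinite
  line. By pure ellipticity \<open>z\<close> fixes a section \<open>x\<close>, and \<open>x\<close> turns out to be \<open>\<Gamma>\<close>-invariant over \<open>O\<close>. The heart
  of the matter is that an element \<open>g\<close> stabilizing \<open>q \<in> O\<close> fixes the value of \<open>x\<close> at \<open>q\<close>
  (\<open>value_fixed_by_stabilizer\<close>). For large \<open>N\<close> the element \<open>z\<^sup>N g\<close> also has an invariant section; it is \<open>x\<^sub>0\<close> far out on
  both ends of the line through \<open>q\<close>, and following it from both ends towards \<open>q\<close> shows that it can only close
  up at \<open>q\<close> if \<open>g\<close> fixes the value there.
\<close>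

section \<open>Finite generation and finite index\<close>

lemma (in group_hom) finitely_generated_image:
  assumes "finitely_generated G"
  shows "finitely_generated (H\<lparr>carrier := h ` carrier G\<rparr>)"
proof -
  obtain S where S: "finite S" "S \<subseteq> carrier G" "generate G S = carrier G"
    using assms by (auto simp: finitely_generated_def)
  have "generate (H\<lparr>carrier := h ` carrier G\<rparr>) (h ` S) = generate H (h ` S)"
    by (rule H.generate_consistent[OF _ img_is_subgroup]) (use S in auto)
  also have "\<dots> = h ` carrier G"
    using generate_img[OF S(2)] S(3) by simp
  finally show ?thesis
    unfolding finitely_generated_def using S by (intro exI[of _ "h ` S"]) auto
qed

text \<open>Schreier's lemma. With \<open>T\<close> a finite system of representatives of the right cosets of \<open>L\<close> and \<open>r g\<close> the
representative of \<open>L g\<close>, rewriting \<open>t s = (t s (r (t s))\<inverse>) (r (t s))\<close> pushes an element of \<open>T\<close> through any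
word in the generators, leaving behind a product of the finitely many elements
\<open>t s (r (t s))\<inverse> \<in> L\<close>. The representative of \<open>L\<close> itself need not be \<open>\<one>\<close>, so it joins the generators.\<close>

lemma (in group) finitely_generated_finite_index:
  assumes fg: "finitely_generated G" and L: "subgroup L G" and fin: "finite (rcosets L)"
  shows "finitely_generated (G\<lparr>carrier := L\<rparr>)"
proof -
  obtain S where S: "finite S" "S \<subseteq> carrier G" "generate G S = carrier G"
    using fg by (auto simp: finitely_generated_def)
  note Lc = subgroup.mem_carrier[OF L]
  define r where "r g = (SOME t. t \<in> L #> g)" for g
  have r: "r g \<in> L #> g" if "g \<in> carrier G" for g
    unfolding r_def using rcos_self[OF that L] by (rule someI)
  have rc: "r g \<in> carrier G" if "g \<in> carrier G" for g
    using r[OF that] r_coset_subset_G[OF subgroup.subset[OF L] that] by blast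
  have quot: "g \<otimes> inv (r g) \<in> L" if g: "g \<in> carrier G" for g
  proof -
    obtain l where l: "l \<in> L" "r g = l \<otimes> g" using r[OF g] by (auto simp: r_coset_def)
    then have "g \<otimes> inv (r g) = inv l"
      using g Lc[OF l(1)] by (simp add: inv_mult_group m_assoc[symmetric])
    then show ?thesis using l L by (simp add: subgroup.m_inv_closed)
  qed
  define T where "T = r ` carrier G"
  have "T \<subseteq> (\<lambda>C. SOME t. t \<in> C) ` (rcosets L)"
    by (auto simp: T_def r_def RCOSETS_def)
  then have finT: "finite T" using fin finite_surj by blast
  have Tc: "T \<subseteq> carrier G" using rc by (auto simp: T_def)
  define S' where "S' = S \<union> m_inv G ` S"
  have S': "finite S'" "S' \<subseteq> carrier G" using S by (auto simp: S'_def)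
  define U where "U = insert (r \<one>) ((\<lambda>(t, s). t \<otimes> s \<otimes> inv (r (t \<otimes> s))) ` (T \<times> S'))"
  have finU: "finite U" using finT S' by (simp add: U_def)
  have r1: "r \<one> \<in> L"
    using r[of \<one>] L by (simp add: coset_mult_one subgroup.subset)
  have UL: "U \<subseteq> L"
  proof -
    have "t \<otimes> s \<otimes> inv (r (t \<otimes> s)) \<in> L" if "t \<in> T" "s \<in> S'" for t s
      using that Tc S' by (intro quot) auto
    then show ?thesis using r1 by (auto simp: U_def)
  qed
  then have Uc: "U \<subseteq> carrier G" using Lc by blast
  have gU: "subgroup (generate G U) G" by (rule generate_is_subgroup[OF Uc])
  note gUc = subgroup.mem_carrier[OF gU]
  \<comment> \<open>The elements that can be pushed through.\<close>
  define M where "M = {g \<in> carrier G. \<forall>t\<in>T. \<exists>u\<in>generate G U. \<exists>t'\<in>T. t \<otimes> g = u \<otimes> t'}"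
  have S'M: "S' \<subseteq> M"
  proof
    fix s assume s: "s \<in> S'"
    have "\<exists>u\<in>generate G U. \<exists>t'\<in>T. t \<otimes> s = u \<otimes> t'" if t: "t \<in> T" for t
    proof (intro bexI)
      have c: "t \<in> carrier G" "s \<in> carrier G" using s t S' Tc by auto
      show "t \<otimes> s = (t \<otimes> s \<otimes> inv (r (t \<otimes> s))) \<otimes> r (t \<otimes> s)"
        using c rc by (simp add: m_assoc)
      show "t \<otimes> s \<otimes> inv (r (t \<otimes> s)) \<in> generate G U"
        by (rule generate.incl) (use s t in \<open>auto simp: U_def\<close>)
      show "r (t \<otimes> s) \<in> T" using c by (simp add: T_def)
    qed
    then show "s \<in> M" using s S' by (auto simp: M_def)
  qed
  have "generate G S \<subseteq> M"
  proof
    fix g assume "g \<in> generate G S"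
    then show "g \<in> M"
    proof induction
      case one
      have "\<exists>u\<in>generate G U. \<exists>t'\<in>T. t \<otimes> \<one> = u \<otimes> t'" if "t \<in> T" for t
        using that Tc generate.one[of G U] by (intro bexI[of _ \<one>] bexI[of _ t]) auto
      then show ?case by (simp add: M_def)
    next
      case (incl h) then show ?case using S'M by (auto simp: S'_def)
    next
      case (inv h) then show ?case using S'M by (auto simp: S'_def)
    next
      case (eng g h)
      have c: "g \<in> carrier G" "h \<in> carrier G" using eng.IH by (auto simp: M_def)
      have "\<exists>u\<in>generate G U. \<exists>t'\<in>T. t \<otimes> (g \<otimes> h) = u \<otimes> t'" if t: "t \<in> T" for t
      proof -
        obtain u t' where 1: "u \<in> generate G U" "t' \<in> T" "t \<otimes> g = u \<otimes> t'"
          using eng.IH(1) t by (auto simp: M_def)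
        obtain v t'' where 2: "v \<in> generate G U" "t'' \<in> T" "t' \<otimes> h = v \<otimes> t''"
          using eng.IH(2) 1 by (auto simp: M_def)
        have tc: "t \<in> carrier G" "t' \<in> carrier G" "t'' \<in> carrier G" using t 1 2 Tc by auto
        have "t \<otimes> (g \<otimes> h) = u \<otimes> (t' \<otimes> h)"
          using 1(3) tc c gUc[OF 1(1)] by (simp add: m_assoc[symmetric])
        also have "\<dots> = (u \<otimes> v) \<otimes> t''"
          using 2(3) tc gUc[OF 1(1)] gUc[OF 2(1)] by (simp add: m_assoc[symmetric])
        finally show ?thesis using generate.eng[OF 1(1) 2(1)] 2(2) by blast
      qed
      then show ?case using c by (simp add: M_def)
    qed
  qed
  then have M: "carrier G \<subseteq> M" using S by simp
  have "L \<subseteq> generate G U"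
  proof
    fix l assume l: "l \<in> L"
    have g: "inv (r \<one>) \<otimes> l \<in> M" using M rc Lc[OF l] by auto
    have "r \<one> \<in> T" by (simp add: T_def)
    then obtain u t where ut: "u \<in> generate G U" "t \<in> T" "r \<one> \<otimes> (inv (r \<one>) \<otimes> l) = u \<otimes> t"
      using g by (auto simp: M_def)
    have lut: "l = u \<otimes> t" using ut(3) rc Lc[OF l] by (simp add: m_assoc[symmetric])
    have uL: "u \<in> L" using ut(1) generate_subgroup_incl[OF UL L] by blast
    have "t = inv u \<otimes> l" using lut ut Tc gUc by (simp add: m_assoc[symmetric] subset_iff)
    then have tL: "t \<in> L" using uL l L by (simp add: subgroup.m_closed subgroup.m_inv_closed)
    obtain g where g: "g \<in> carrier G" "t = r g" using ut(2) by (auto simp: T_def)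
    have "L #> g = L #> t"
      using repr_independence[OF r[OF g(1)] g(1) L] g(2) by simp
    also have "\<dots> = L #> \<one>"
      using subgroup.rcos_const[OF L is_group tL] L by (simp add: coset_mult_one subgroup.subset)
    finally have "t = r \<one>" using g(2) by (simp add: r_def)
    then have "t \<in> generate G U" by (auto simp: U_def intro: generate.incl)
    then show "l \<in> generate G U" using lut ut(1) by (auto intro: generate.eng)
  qed
  moreover have "generate G U \<subseteq> L" by (rule generate_subgroup_incl[OF UL L])
  ultimately have "generate (G\<lparr>carrier := L\<rparr>) U = L"
    using generate_consistent[OF UL L] by simp
  then show ?thesis
    unfolding finitely_generated_def using finU UL by auto
qed

lemma (in group_hom) preimage_subgroup:
  assumes N: "subgroup N H"
  shows "subgroup {g \<in> carrier G. h g \<in> N} G"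
  using subgroup.one_closed[OF N] subgroup.m_closed[OF N] subgroup.m_inv_closed[OF N]
  by (intro G.subgroupI) auto

lemma (in group_hom) preimage_finite_index:
  assumes N: "subgroup N H" and fin: "finite (rcosets\<^bsub>H\<^esub> N)"
  shows "finite (rcosets\<^bsub>G\<^esub> {g \<in> carrier G. h g \<in> N})"
proof -
  let ?L = "{g \<in> carrier G. h g \<in> N}"
  have L: "subgroup ?L G" by (rule preimage_subgroup[OF N])
  have "?L #>\<^bsub>G\<^esub> g = {g' \<in> carrier G. h g' \<in> N #>\<^bsub>H\<^esub> h g}" if g: "g \<in> carrier G" for g
  proof -
    have "g' \<in> ?L #>\<^bsub>G\<^esub> g \<longleftrightarrow> h g' \<in> N #>\<^bsub>H\<^esub> h g" if "g' \<in> carrier G" for g'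
      using subgroup.rcos_module[OF L G.is_group g that] subgroup.rcos_module[OF N H.is_group, of "h g" "h g'"]
        g that by simp
    then show ?thesis using G.r_coset_subset_G[OF subgroup.subset[OF L] g] by blast
  qed
  then have "rcosets\<^bsub>G\<^esub> ?L \<subseteq> (\<lambda>D. {g' \<in> carrier G. h g' \<in> D}) ` (rcosets\<^bsub>H\<^esub> N)"
    by (auto simp: RCOSETS_def image_iff) (metis hom_closed)
  then show ?thesis using fin finite_surj by blast
qed


section \<open>Lower central series and central elements of infinite order\<close>

declare lower_central.simps(2) [simp del]

context group begin

abbreviation commutator :: "'a \<Rightarrow> 'a \<Rightarrow> 'a" where
  "commutator x y \<equiv> x \<otimes> y \<otimes> inv x \<otimes> inv y"

lemma cancel_left:
  assumes "x \<in> carrier G" "y \<in> carrier G"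
  shows "inv x \<otimes> (x \<otimes> y) = y" "x \<otimes> (inv x \<otimes> y) = y"
  using assms by (simp_all add: m_assoc[symmetric])

lemma inv_commutator:
  assumes "x \<in> carrier G" "y \<in> carrier G"
  shows "inv (commutator x y) = commutator y x"
  using assms by (simp add: inv_mult_group m_assoc)

lemma conj_eq_commutator:
  assumes "k \<in> carrier G" "g \<in> carrier G"
  shows "g \<otimes> k \<otimes> inv g = commutator g k \<otimes> k"
  using assms by (simp add: m_assoc)

lemma normal_if_commutators:
  assumes K: "subgroup K G" and c: "\<And>g k. g \<in> carrier G \<Longrightarrow> k \<in> K \<Longrightarrow> commutator g k \<in> K"
  shows "K \<lhd> G"
proof (rule normal_invI[OF K])
  fix g k assume "g \<in> carrier G" "k \<in> K"
  then show "g \<otimes> k \<otimes> inv g \<in> K"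
    using subgroup.m_closed[OF K c[of g k], of k] K conj_eq_commutator[of k g]
    by (metis subgroup.mem_carrier)
qed

lemma commutator_swap_mem:
  assumes "subgroup K G" "x \<in> carrier G" "y \<in> carrier G" "commutator x y \<in> K"
  shows "commutator y x \<in> K"
  using inv_commutator[OF assms(2,3)] subgroup.m_inv_closed[OF assms(1,4)] by simp

text \<open>This set is the preimage of the centralizer of the class of \<open>y\<close> in \<open>G / K\<close>. Checking commutation with a whole
subgroup modulo \<open>K\<close> is thereby reduced to checking it on generators.\<close>

lemma subgroup_commuting_mod:
  assumes K: "K \<lhd> G" and y: "y \<in> carrier G"
  shows "subgroup {x \<in> carrier G. commutator x y \<in> K} G"
proof (rule subgroupI)
  note sK = normal_imp_subgroup[OF K]
  have cj: "g \<otimes> k \<otimes> inv g \<in> K" if "g \<in> carrier G" "k \<in> K" for g k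
    using K that normal_inv_iff by blast
  show "{x \<in> carrier G. commutator x y \<in> K} \<noteq> {}"
    using y subgroup.one_closed[OF sK] by (intro ex_in_conv[THEN iffD1] exI[of _ \<one>]) simp
  fix x assume "x \<in> {x \<in> carrier G. commutator x y \<in> K}"
  then have x: "x \<in> carrier G" "commutator x y \<in> K" by auto
  have "commutator (inv x) y = inv x \<otimes> inv (commutator x y) \<otimes> inv (inv x)"
    using x(1) y by (subst inv_commutator) (simp_all add: m_assoc)
  then show "inv x \<in> {x \<in> carrier G. commutator x y \<in> K}"
    using cj[of "inv x" "inv (commutator x y)"] subgroup.m_inv_closed[OF sK x(2)] x(1) by simp
  fix x' assume "x' \<in> {x \<in> carrier G. commutator x y \<in> K}"
  then have x': "x' \<in> carrier G" "commutator x' y \<in> K" by auto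
  have "commutator (x \<otimes> x') y = (x \<otimes> commutator x' y \<otimes> inv x) \<otimes> commutator x y"
    using x(1) x'(1) y by (simp add: inv_mult_group m_assoc cancel_left)
  then show "x \<otimes> x' \<in> {x \<in> carrier G. commutator x y \<in> K}"
    using cj[OF x(1) x'(2)] x x' subgroup.m_closed[OF sK] by simp
qed auto

lemma commutator_in_lower_central:
  assumes "x \<in> lower_central G n" "y \<in> carrier G"
  shows "commutator x y \<in> lower_central G (Suc n)"
  using assms unfolding lower_central.simps by (auto intro!: generate.incl)

text \<open>Both facts go through one induction: normality of a term puts the next term inside it, and this inclusion
is what makes the next term normal.\<close>

lemma lower_central_normal_antimono:
  "lower_central G n \<lhd> G \<and> lower_central G (Suc n) \<subseteq> lower_central G n"
proof (induction n)
  case 0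
  have "lower_central G 0 \<lhd> G"
    by (rule normal_invI) (auto simp: subgroup_self)
  moreover have "lower_central G (Suc 0) \<subseteq> lower_central G 0"
    unfolding lower_central.simps by (rule generate_incl) auto
  ultimately show ?case by blast
next
  case (Suc n)
  let ?A = "lower_central G n" and ?B = "lower_central G (Suc n)"
  have sA: "subgroup ?A G" using Suc normal_imp_subgroup by blast
  have sB: "subgroup ?B G" unfolding lower_central.simps
    by (rule generate_is_subgroup) (use subgroup.mem_carrier[OF sA] in auto)
  have B: "?B \<lhd> G"
  proof (rule normal_if_commutators[OF sB])
    fix g k assume g: "g \<in> carrier G" and k: "k \<in> ?B"
    have "k \<in> ?A" using Suc k by blast
    then show "commutator g k \<in> ?B"
      using commutator_in_lower_central[of k n g] g commutator_swap_mem[OF sB _ g] subgroup.mem_carrier[OF sA]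
      by blast
  qed
  have "generate G (\<Union>x\<in>?B. \<Union>y\<in>carrier G. {commutator x y}) \<subseteq> ?B"
  proof (rule generate_subgroup_incl[OF _ sB], clarify)
    fix x y assume x: "x \<in> ?B" and y: "y \<in> carrier G"
    have xc: "x \<in> carrier G" using x subgroup.mem_carrier[OF sB] by blast
    have "commutator x y = x \<otimes> (y \<otimes> inv x \<otimes> inv y)"
      using xc y by (simp add: m_assoc)
    moreover have "y \<otimes> inv x \<otimes> inv y \<in> ?B"
      using B x y subgroup.m_inv_closed[OF sB x] normal_inv_iff by blast
    ultimately show "commutator x y \<in> ?B" using subgroup.m_closed[OF sB x] by metis
  qed
  then show ?case using B by (simp only: lower_central.simps(2)[where n = "Suc n"])
qed

lemma lower_central_normal: "lower_central G n \<lhd> G"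
  and lower_central_Suc_subset: "lower_central G (Suc n) \<subseteq> lower_central G n"
  using lower_central_normal_antimono by auto

text \<open>Each quotient of consecutive terms is generated by the commutators \<open>[t, s]\<close> of generators \<open>t\<close> of the previous
quotient with generators \<open>s\<close> of \<open>G\<close>. Indeed, let \<open>K\<close> be generated by these commutators and the term two steps
further down. Modulo \<open>K\<close> every \<open>t\<close> commutes with all \<open>s\<close>, hence with \<open>G\<close>; therefore every element of \<open>G\<close>
commutes with all \<open>t\<close>, hence with the whole term.\<close>

lemma lower_central_finitely_generated_mod:
  assumes fg: "finitely_generated G"
  shows "\<exists>T. finite T \<and> T \<subseteq> lower_central G n \<and>
           lower_central G n = generate G (T \<union> lower_central G (Suc n))"
proof (induction n)
  case 0
  obtain S where S: "finite S" "S \<subseteq> carrier G" "generate G S = carrier G"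
    using fg by (auto simp: finitely_generated_def)
  have sub: "S \<union> lower_central G (Suc 0) \<subseteq> carrier G"
    using S lower_central_Suc_subset[of 0] by auto
  have "carrier G \<subseteq> generate G (S \<union> lower_central G (Suc 0))"
    using mono_generate[of S "S \<union> lower_central G (Suc 0)"] S by auto
  then have "lower_central G 0 = generate G (S \<union> lower_central G (Suc 0))"
    using generate_incl[OF sub] by auto
  then show ?case using S by (intro exI[of _ S]) simp
next
  case (Suc n)
  let ?A = "lower_central G n" and ?B = "lower_central G (Suc n)" and ?C = "lower_central G (Suc (Suc n))"
  obtain S where S: "finite S" "S \<subseteq> carrier G" "generate G S = carrier G"
    using fg by (auto simp: finitely_generated_def)
  obtain T where T: "finite T" "T \<subseteq> ?A" "?A = generate G (T \<union> ?B)"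
    using Suc.IH by (elim exE conjE) (rule that)
  have sA: "subgroup ?A G" and sB: "subgroup ?B G" and sC: "subgroup ?C G"
    by (rule normal_imp_subgroup[OF lower_central_normal])+
  note Ac = subgroup.mem_carrier[OF sA] and Bc = subgroup.mem_carrier[OF sB]
  define T' where "T' = (\<lambda>(t, s). commutator t s) ` (T \<times> S)"
  have T'B: "T' \<subseteq> ?B"
  proof -
    have "commutator t s \<in> ?B" if "t \<in> T" "s \<in> S" for t s
      using that T(2) S(2) by (intro commutator_in_lower_central) auto
    then show ?thesis by (auto simp: T'_def)
  qed
  define K where "K = generate G (T' \<union> ?C)"
  have TCB: "T' \<union> ?C \<subseteq> ?B" using T'B lower_central_Suc_subset[of "Suc n"] by blast
  have sK: "subgroup K G" unfolding K_def by (rule generate_is_subgroup) (use TCB Bc in blast)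
  have KB: "K \<subseteq> ?B" unfolding K_def by (rule generate_subgroup_incl[OF TCB sB])
  have CK: "?C \<subseteq> K" unfolding K_def by (auto intro: generate.incl)
  have K: "K \<lhd> G"
  proof (rule normal_if_commutators[OF sK])
    fix g k assume g: "g \<in> carrier G" and k: "k \<in> K"
    have "commutator k g \<in> K"
      using CK KB k g commutator_in_lower_central[of k "Suc n" g] by auto
    then show "commutator g k \<in> K"
      using commutator_swap_mem[OF sK _ g] subgroup.mem_carrier[OF sK k] by blast
  qed
  have tK: "commutator t y \<in> K" if t: "t \<in> T" and y: "y \<in> carrier G" for t y
  proof -
    have tc: "t \<in> carrier G" using t T Ac by blast
    have "S \<subseteq> {x \<in> carrier G. commutator x t \<in> K}"
    proof
      fix s assume s: "s \<in> S"
      have "commutator t s \<in> K" unfolding K_def using s t by (auto intro!: generate.incl simp: T'_def)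
      then show "s \<in> {x \<in> carrier G. commutator x t \<in> K}"
        using s S tc commutator_swap_mem[OF sK tc] by blast
    qed
    from generate_subgroup_incl[OF this subgroup_commuting_mod[OF K tc]] S y
    have "commutator y t \<in> K" by blast
    then show ?thesis using commutator_swap_mem[OF sK y tc] by blast
  qed
  have AK: "commutator x y \<in> K" if x: "x \<in> ?A" and y: "y \<in> carrier G" for x y
  proof -
    have "commutator b y \<in> K" if "b \<in> ?B" for b
      using that CK commutator_in_lower_central[OF that y] by auto
    then have "T \<union> ?B \<subseteq> {x \<in> carrier G. commutator x y \<in> K}"
      using tK[OF _ y] T(2) Ac Bc by auto
    from generate_subgroup_incl[OF this subgroup_commuting_mod[OF K y]] T x
    show ?thesis by blast
  qed
  have "?B \<subseteq> K"
    unfolding lower_central.simps(2)[where n = n]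
    by (rule generate_subgroup_incl[OF _ sK]) (use AK in blast)
  then have "?B = generate G (T' \<union> ?C)" using KB unfolding K_def by blast
  moreover have "finite T'" using S(1) T(1) by (simp add: T'_def)
  ultimately show ?case using T'B by blast
qed

end

text \<open>Modulo \<open>F\<close> the group is abelian, so a finite set of torsion elements generates a finite group. Adding one
generator \<open>t\<close> at a time works because a subgroup containing all commutators is normal: the new
subgroup is the product of the old one with the finite cyclic group generated by \<open>t\<close>.\<close>

lemma (in group) finite_if_torsion_generators:
  assumes F: "subgroup F G" "finite F"
    and c: "\<And>x y. x \<in> carrier G \<Longrightarrow> y \<in> carrier G \<Longrightarrow> commutator x y \<in> F"
    and T: "finite T" "T \<subseteq> carrier G" "\<And>t. t \<in> T \<Longrightarrow> \<exists>n>0::nat. t [^] n = \<one>"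
  shows "finite (generate G (T \<union> F))"
  using T
proof (induction T rule: finite_induct)
  case empty
  have "generate G F \<subseteq> F" by (rule generate_subgroup_incl[OF _ F(1)]) simp
  then show ?case using F finite_subset by auto
next
  case (insert t T)
  let ?B = "generate G (T \<union> F)" and ?C = "generate G {t}"
  have tc: "t \<in> carrier G" using insert by simp
  have sB: "subgroup ?B G"
    using insert subgroup.subset[OF F(1)] by (intro generate_is_subgroup) auto
  have B: "?B \<lhd> G"
    by (rule normal_if_commutators[OF sB])
       (use c subgroup.mem_carrier[OF sB] in \<open>blast intro: generate.incl\<close>)
  have sC: "subgroup ?C G" by (rule generate_is_subgroup) (use tc in auto)
  obtain n :: nat where n: "n > 0" "t [^] n = \<one>" using insert by auto
  have "?C \<subseteq> (\<lambda>k. t [^] k) ` {..<n}"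
  proof
    fix x assume "x \<in> ?C"
    then obtain k :: int where k: "x = t [^] k" using generate_pow[OF tc] by auto
    have tn: "t [^] (int n) = \<one>" using n by (simp add: int_pow_int)
    have "k = int n * (k div int n) + int (nat (k mod int n))" using n by simp
    then have "x = t [^] (int n * (k div int n) + int (nat (k mod int n)))" using k by simp
    also have "\<dots> = (t [^] int n) [^] (k div int n) \<otimes> t [^] int (nat (k mod int n))"
      using tc by (simp add: int_pow_mult int_pow_pow)
    also have "\<dots> = t [^] (nat (k mod int n))" using tn tc by (simp add: int_pow_int)
    finally show "x \<in> (\<lambda>k. t [^] k) ` {..<n}"
      using n by (intro image_eqI[of _ _ "nat (k mod int n)"]) (auto simp: nat_less_iff)
  qed
  then have finC: "finite ?C" using finite_surj by blast
  have finB: "finite ?B" using insert by simp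
  have sM: "subgroup (?B <#> ?C) G" by (rule mult_norm_subgroup[OF B sC])
  have "insert t T \<union> F \<subseteq> ?B <#> ?C"
  proof
    fix x assume x: "x \<in> insert t T \<union> F"
    show "x \<in> ?B <#> ?C"
    proof (cases "x = t")
      case True
      then have "x = \<one> \<otimes> t" using tc by simp
      then show ?thesis unfolding set_mult_def using generate.one[of G "T \<union> F"] generate.incl[of t "{t}"] by blast
    next
      case False
      then have "x \<in> ?B" using x by (auto intro: generate.incl)
      moreover have "x = x \<otimes> \<one>" using calculation subgroup.mem_carrier[OF sB] by simp
      ultimately show ?thesis unfolding set_mult_def using generate.one[of G "{t}"] by blast
    qed
  qed
  from generate_subgroup_incl[OF this sM]
  have "generate G (insert t T \<union> F) \<subseteq> ?B <#> ?C" .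
  moreover have "finite (?B <#> ?C)" unfolding set_mult_def using finB finC by simp
  ultimately show ?case by (rule finite_subset)
qed

text \<open>For a fixed \<open>s\<close> the commutators \<open>[z\<^sup>n, s]\<close> lie in the finite group \<open>F\<close>, so two of them coincide, and then a
positive power of \<open>z\<close> commutes with \<open>s\<close>. A common multiple of the exponents serves a finite generating set.\<close>

lemma (in group) central_power_if_central_mod_finite:
  assumes fg: "finitely_generated G" and F: "F \<lhd> G" "finite F"
    and z: "z \<in> carrier G" "\<And>g. g \<in> carrier G \<Longrightarrow> commutator z g \<in> F"
  shows "\<exists>m>0::nat. \<forall>g\<in>carrier G. z [^] m \<otimes> g = g \<otimes> z [^] m"
proof -
  obtain S where S: "finite S" "S \<subseteq> carrier G" "generate G S = carrier G"
    using fg by (auto simp: finitely_generated_def)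
  have one: "\<exists>m>0::nat. z [^] m \<otimes> s = s \<otimes> z [^] m" if s: "s \<in> carrier G" for s
  proof -
    have sg: "subgroup {x \<in> carrier G. commutator x s \<in> F} G" by (rule subgroup_commuting_mod[OF F(1) s])
    have inF: "commutator (z [^] (n::nat)) s \<in> F" for n
      using subgroup_int_pow_closed[OF sg, of z "int n"] z s by (simp add: int_pow_int)
    have "\<not> inj (\<lambda>n::nat. commutator (z [^] n) s)"
      using F(2) inF finite_subset[of "range (\<lambda>n::nat. commutator (z [^] n) s)" F] range_inj_infinite by blast
    then obtain i j :: nat where ij: "i < j" "commutator (z [^] i) s = commutator (z [^] j) s"
      unfolding inj_def by (metis linorder_neqE_nat)
    have zj: "z [^] j = z [^] i \<otimes> z [^] (j - i)" using ij z by (simp add: nat_pow_mult)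
    define u where "u = z [^] i"
    define v where "v = z [^] (j - i)"
    have uv: "u \<in> carrier G" "v \<in> carrier G" using z by (auto simp: u_def v_def)
    have "u \<otimes> s \<otimes> inv u \<otimes> inv s = (u \<otimes> v) \<otimes> s \<otimes> inv (u \<otimes> v) \<otimes> inv s"
      using ij(2) zj by (simp add: u_def v_def)
    then have "s \<otimes> (inv u \<otimes> inv s) = (v \<otimes> s \<otimes> inv v) \<otimes> (inv u \<otimes> inv s)"
      using uv s by (simp add: inv_mult_group m_assoc)
    then have "s = v \<otimes> s \<otimes> inv v"
      using uv s r_cancel[of "inv u \<otimes> inv s" s "v \<otimes> s \<otimes> inv v"] by simp
    then have "s \<otimes> v = v \<otimes> s"
      using uv s by (metis inv_solve_right' m_closed inv_closed inv_solve_right)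
    then have "z [^] (j - i) \<otimes> s = s \<otimes> z [^] (j - i)" by (simp add: v_def)
    then show ?thesis using ij by (intro exI[of _ "j - i"]) auto
  qed
  have "\<exists>m>0::nat. \<forall>s\<in>S. z [^] m \<otimes> s = s \<otimes> z [^] m"
    using S(1,2)
  proof (induction S rule: finite_induct)
    case empty show ?case by auto
  next
    case (insert s S)
    obtain m where m: "m > 0" "\<forall>s\<in>S. z [^] m \<otimes> s = s \<otimes> z [^] (m::nat)" using insert by auto
    obtain k where k: "k > 0" "z [^] k \<otimes> s = s \<otimes> z [^] (k::nat)" using one[of s] insert.prems by auto
    have "z [^] (m * k) \<otimes> t = t \<otimes> z [^] (m * k)" if "t \<in> insert s S" for t
    proof (cases "t \<in> S")
      case True
      then show ?thesis using m insert.prems z group_commutes_pow[of "z [^] m" t k] by (auto simp: nat_pow_pow)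
    next
      case False
      then show ?thesis using k that insert.prems z group_commutes_pow[of "z [^] k" s m]
        by (auto simp: nat_pow_pow mult.commute)
    qed
    then show ?case using m k by (intro exI[of _ "m * k"]) auto
  qed
  then obtain m :: nat where m: "m > 0" "\<forall>s\<in>S. z [^] m \<otimes> s = s \<otimes> z [^] m" by blast
  let ?Z = "{g \<in> carrier G. z [^] m \<otimes> g = g \<otimes> z [^] m}"
  have "subgroup ?Z G"
  proof (rule subgroupI)
    show "?Z \<noteq> {}" using z by (intro ex_in_conv[THEN iffD1] exI[of _ \<one>]) simp
    fix x assume x: "x \<in> ?Z"
    have zm: "z [^] m \<in> carrier G" using z by simp
    have xc: "x \<in> carrier G" and xz: "z [^] m \<otimes> x = x \<otimes> z [^] m" using x by auto
    have "inv x \<otimes> z [^] m = inv x \<otimes> (z [^] m \<otimes> x) \<otimes> inv x"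
      using xc zm by (simp add: m_assoc)
    also have "\<dots> = z [^] m \<otimes> inv x"
      unfolding xz using xc zm by (simp add: m_assoc[symmetric])
    finally show "inv x \<in> ?Z" using xc by simp
    fix y assume y: "y \<in> ?Z"
    have "z [^] m \<otimes> (x \<otimes> y) = (x \<otimes> z [^] m) \<otimes> y" using x y zm by (simp add: m_assoc[symmetric])
    also have "\<dots> = (x \<otimes> y) \<otimes> z [^] m" using x y zm by (simp add: m_assoc)
    finally show "x \<otimes> y \<in> ?Z" using x y by simp
  qed auto
  from generate_subgroup_incl[OF _ this, of S] have "carrier G \<subseteq> ?Z" using m S by auto
  then show ?thesis using m by blast
qed

text \<open>Somewhere along the lower central series an infinite term is followed by a finite one. The infinite term is
finitely generated modulo the finite one and abelian modulo it, so some generator \<open>z\<close> has infinite order, as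
torsion generators would make the term finite. Since \<open>z\<close> is central modulo the finite term, some positive power
of it is central.\<close>

lemma (in group) nilpotent_central_element_infinite_order:
  assumes fg: "finitely_generated G" and inf: "infinite (carrier G)" and nil: "lower_central G c = {\<one>}"
  shows "\<exists>z\<in>carrier G. (\<forall>g\<in>carrier G. z \<otimes> g = g \<otimes> z) \<and> (\<forall>n>0::nat. z [^] n \<noteq> \<one>)"
proof -
  have "\<exists>i. infinite (lower_central G i) \<and> finite (lower_central G (Suc i))"
  proof (rule ccontr)
    assume "\<not> ?thesis"
    then have "infinite (lower_central G i)" for i by (induction i) (use inf in auto)
    then show False using nil by (metis finite.emptyI finite_insert)
  qed
  then obtain i where i: "infinite (lower_central G i)" "finite (lower_central G (Suc i))" by blast
  let ?A = "lower_central G i" and ?F = "lower_central G (Suc i)"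
  have sA: "subgroup ?A G" and F: "?F \<lhd> G" and sF: "subgroup ?F G"
    using lower_central_normal normal_imp_subgroup by blast+
  note Ac = subgroup.mem_carrier[OF sA]
  obtain T where T: "finite T" "T \<subseteq> ?A" "?A = generate G (T \<union> ?F)"
    using lower_central_finitely_generated_mod[OF fg] by blast
  interpret A: group "G\<lparr>carrier := ?A\<rparr>" by (rule subgroup.subgroup_is_group[OF sA is_group])
  have FA: "?F \<subseteq> ?A" by (rule lower_central_Suc_subset)
  have "\<exists>t\<in>T. \<forall>n>0::nat. t [^] n \<noteq> \<one>"
  proof (rule ccontr)
    assume "\<not> ?thesis"
    then have tor: "\<exists>n>0::nat. t [^] n = \<one>" if "t \<in> T" for t using that by blast
    have "finite (generate (G\<lparr>carrier := ?A\<rparr>) (T \<union> ?F))"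
    proof (rule A.finite_if_torsion_generators)
      show "subgroup ?F (G\<lparr>carrier := ?A\<rparr>)"
        by (rule subgroup_incl[OF sF sA FA])
      show "finite ?F" by (rule i(2))
      show "finite T" by (rule T(1))
      show "T \<subseteq> carrier (G\<lparr>carrier := ?A\<rparr>)" using T(2) by simp
      show "\<exists>n>0. t [^]\<^bsub>G\<lparr>carrier := ?A\<rparr>\<^esub> (n::nat) = \<one>\<^bsub>G\<lparr>carrier := ?A\<rparr>\<^esub>" if "t \<in> T" for t
        using tor[OF that] by (simp add: nat_pow_consistent[symmetric])
      show "A.commutator x y \<in> ?F" if "x \<in> carrier (G\<lparr>carrier := ?A\<rparr>)" "y \<in> carrier (G\<lparr>carrier := ?A\<rparr>)" for x y
        using commutator_in_lower_central[of x i y] that Ac m_inv_consistent[OF sA] by simp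
    qed
    moreover have "generate (G\<lparr>carrier := ?A\<rparr>) (T \<union> ?F) = ?A"
      using generate_consistent[of "T \<union> ?F" ?A] T FA sA by simp
    ultimately show False using i by simp
  qed
  then obtain z where z: "z \<in> ?A" "\<forall>n>0::nat. z [^] n \<noteq> \<one>" using T by blast
  obtain m :: nat where m: "m > 0" "\<forall>g\<in>carrier G. z [^] m \<otimes> g = g \<otimes> z [^] m"
    using central_power_if_central_mod_finite[OF fg F i(2) Ac[OF z(1)]]
      commutator_in_lower_central[OF z(1)] by blast
  then show ?thesis using z Ac
    by (intro bexI[of _ "z [^] m"]) (auto simp: nat_pow_pow)
qed

lemma (in group_hom) lower_central_image:
  assumes surj: "h ` carrier G = carrier H"
  shows "lower_central H n = h ` lower_central G n"
proof (induction n)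
  case 0 show ?case using surj by simp
next
  case (Suc n)
  let ?c = "\<lambda>x y. x \<otimes>\<^bsub>G\<^esub> y \<otimes>\<^bsub>G\<^esub> inv\<^bsub>G\<^esub> x \<otimes>\<^bsub>G\<^esub> inv\<^bsub>G\<^esub> y"
  let ?K = "\<Union>x\<in>lower_central G n. \<Union>y\<in>carrier G. {?c x y}"
  have A: "lower_central G n \<subseteq> carrier G"
    using G.lower_central_normal normal_imp_subgroup subgroup.subset by blast
  have hc: "h (?c x y) = h x \<otimes>\<^bsub>H\<^esub> h y \<otimes>\<^bsub>H\<^esub> inv\<^bsub>H\<^esub> h x \<otimes>\<^bsub>H\<^esub> inv\<^bsub>H\<^esub> h y"
    if "x \<in> carrier G" "y \<in> carrier G" for x y using that by simp
  have K: "?K \<subseteq> carrier G" using A by auto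
  have "(\<Union>x\<in>h ` lower_central G n. \<Union>y\<in>h ` carrier G. {x \<otimes>\<^bsub>H\<^esub> y \<otimes>\<^bsub>H\<^esub> inv\<^bsub>H\<^esub> x \<otimes>\<^bsub>H\<^esub> inv\<^bsub>H\<^esub> y}) = h ` ?K"
    using hc A by (auto simp: subset_iff image_iff) blast+
  then show ?case
    unfolding lower_central.simps Suc.IH surj[symmetric] using generate_img[OF K] by simp
qed


section \<open>Group actions on trivial bundles and their invariant sections\<close>

lemma int_set_bounded:
  assumes "finite (B :: int set)"
  shows "\<exists>N::nat. N > 0 \<and> (\<forall>n\<in>B. \<bar>n\<bar> < int N)"
proof -
  have "finite (abs ` B)" using assms by simp
  then obtain M where M: "\<forall>n\<in>B. \<bar>n\<bar> \<le> M" using bdd_above.E[OF bdd_above_finite] by (metis imageI)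
  have "\<bar>n\<bar> < int (nat M + 1)" if "n \<in> B" for n using M that by fastforce
  then show ?thesis by (intro exI[of _ "nat M + 1"]) auto
qed

text \<open>A group acting on the trivial bundle \<open>P \<times> Y\<close> over an action on \<open>P\<close>: the element \<open>g\<close> carries the fibre over
\<open>p\<close> to the fibre over \<open>a g p\<close> by \<open>\<tau> g p\<close>. An element of the wreath product is such a bundle map, and a point of
the product is fixed by it exactly if it is an invariant section. The last three assumptions say that the
constant section \<open>base\<close> is almost preserved, and that point stabilizers act decently on their fibres.\<close>

locale bundle_action = group_action G P a
  for G :: "('g, 'm) monoid_scheme" (structure) and P :: "'p set" and a :: "'g \<Rightarrow> 'p \<Rightarrow> 'p" +
  fixes Y :: "'x set" and base :: 'x and \<tau> :: "'g \<Rightarrow> 'p \<Rightarrow> 'x \<Rightarrow> 'x"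
  assumes base: "base \<in> Y"
    and transport_closed: "\<lbrakk>g \<in> carrier G; p \<in> P; y \<in> Y\<rbrakk> \<Longrightarrow> \<tau> g p y \<in> Y"
    and transport_one: "\<lbrakk>p \<in> P; y \<in> Y\<rbrakk> \<Longrightarrow> \<tau> \<one> p y = y"
    and transport_mult: "\<lbrakk>g \<in> carrier G; h \<in> carrier G; p \<in> P; y \<in> Y\<rbrakk>
      \<Longrightarrow> \<tau> (g \<otimes> h) p y = \<tau> g (a h p) (\<tau> h p y)"
    and transport_base: "g \<in> carrier G \<Longrightarrow> finite {p \<in> P. \<tau> g p base \<noteq> base}"
    and fibre_fixed_if_finite_orbit:
      "\<lbrakk>p \<in> P; subgroup K G; K \<subseteq> stabilizer G a p; y \<in> Y; finite ((\<lambda>k. \<tau> k p y) ` K)\<rbrakk>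
        \<Longrightarrow> \<exists>y\<in>Y. \<forall>k\<in>K. \<tau> k p y = y"
    and fibre_fixed_if_elliptic:
      "\<lbrakk>p \<in> P; subgroup K G; K \<subseteq> stabilizer G a p; finitely_generated (G\<lparr>carrier := K\<rparr>);
        \<forall>k\<in>K. \<exists>y\<in>Y. \<tau> k p y = y\<rbrakk> \<Longrightarrow> \<exists>y\<in>Y. \<forall>k\<in>K. \<tau> k p y = y"
begin

sublocale group G
  by (rule group_action_group[OF group_action_axioms])

lemmas a_closed = group_action_closed[OF group_action_axioms]
  and a_mult = group_action_comp[OF group_action_axioms]
  and a_one = group_action_one[OF group_action_axioms]

lemma a_inv:
  assumes "g \<in> carrier G" "p \<in> P"
  shows "a (inv g) (a g p) = p" "a g (a (inv g) p) = p"
  using assms a_mult[of "inv g" g p] a_mult[of g "inv g" p] a_one by auto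

lemma transport_inv:
  assumes "g \<in> carrier G" "p \<in> P" "y \<in> Y"
  shows "\<tau> (inv g) (a g p) (\<tau> g p y) = y"
  using assms transport_mult[of "inv g" g p y] transport_one by simp

lemma transport_inj:
  assumes "g \<in> carrier G" "p \<in> P" "y \<in> Y" "y' \<in> Y" "\<tau> g p y = \<tau> g p y'"
  shows "y = y'"
  using transport_inv[OF assms(1-3)] transport_inv[OF assms(1,2,4)] assms(5) by metis

definition invariant :: "'g \<Rightarrow> ('p \<Rightarrow> 'x) \<Rightarrow> bool" where
  "invariant g x \<longleftrightarrow> (\<forall>p\<in>P. x (a g p) = \<tau> g p (x p))"

text \<open>Sections over a union of orbits are total functions on \<open>'p\<close> whose values elsewhere are arbitrary.\<close>

definition invariant_over :: "'p set \<Rightarrow> ('p \<Rightarrow> 'x) \<Rightarrow> bool" where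
  "invariant_over Q s \<longleftrightarrow>
     (\<forall>q\<in>Q. s q \<in> Y \<and> (\<forall>g\<in>carrier G. s (a g q) = \<tau> g q (s q))) \<and> finite {q \<in> Q. s q \<noteq> base}"

abbreviation sections :: "('p \<Rightarrow> 'x) set" where
  "sections \<equiv> restricted_power P Y base"

lemma section_in: "x \<in> sections \<Longrightarrow> p \<in> P \<Longrightarrow> x p \<in> Y"
  by (auto simp: restricted_power_def)

lemma section_support: "x \<in> sections \<Longrightarrow> finite {p \<in> P. x p \<noteq> base}"
  by (auto simp: restricted_power_def)

lemma orbitI: "g \<in> carrier G \<Longrightarrow> a g p \<in> orbit G a p"
  by (auto simp: orbit_def)

lemma orbit_subset: "p \<in> P \<Longrightarrow> orbit G a p \<subseteq> P"
  using a_closed by (auto simp: orbit_def)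

lemma orbit_eq:
  assumes "p \<in> P" "q \<in> orbit G a p"
  shows "orbit G a q = orbit G a p"
proof -
  have q: "q \<in> P" using assms orbit_subset by blast
  show ?thesis
    using orbit_trans[OF assms(1) q _ assms(2)] orbit_trans[OF q assms(1) _ orbit_sym[OF assms(1) q assms(2)]]
      orbit_subset assms(1) q by blast
qed

text \<open>The value at \<open>a g p\<close> has to be the transport of \<open>y\<close> by \<open>g\<close>; it does not depend on the choice of \<open>g\<close> because two
choices differ by an element of the stabilizer.\<close>

lemma invariant_extension:
  assumes p: "p \<in> P" and y: "y \<in> Y" and fixed: "\<And>g. g \<in> stabilizer G a p \<Longrightarrow> \<tau> g p y = y"
  shows "\<exists>s. (\<forall>g\<in>carrier G. s (a g p) = \<tau> g p y) \<and>
    (\<forall>q\<in>orbit G a p. s q \<in> Y \<and> (\<forall>g\<in>carrier G. s (a g q) = \<tau> g q (s q)))"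
proof -
  define s where "s q = \<tau> (SOME g. g \<in> carrier G \<and> a g p = q) p y" for q
  have s: "s (a g p) = \<tau> g p y" if g: "g \<in> carrier G" for g
  proof -
    define h where "h = (SOME h. h \<in> carrier G \<and> a h p = a g p)"
    have h: "h \<in> carrier G" "a h p = a g p"
      using someI[of "\<lambda>h. h \<in> carrier G \<and> a h p = a g p" g] g by (auto simp: h_def)
    have "inv g \<otimes> h \<in> stabilizer G a p"
      using g h p by (simp add: stabilizer_def a_mult a_inv)
    then have f: "\<tau> (inv g \<otimes> h) p y = y" by (rule fixed)
    have "\<tau> h p y = \<tau> (g \<otimes> (inv g \<otimes> h)) p y"
      using g h by (simp add: m_assoc[symmetric])
    also have "\<dots> = \<tau> g (a (inv g \<otimes> h) p) y"
      using f g h p y by (subst transport_mult) auto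
    also have "a (inv g \<otimes> h) p = p"
      using g h p by (simp add: a_mult a_inv)
    finally show ?thesis by (simp add: s_def h_def)
  qed
  have "s q \<in> Y \<and> (\<forall>g\<in>carrier G. s (a g q) = \<tau> g q (s q))" if "q \<in> orbit G a p" for q
  proof -
    obtain h where h: "h \<in> carrier G" "q = a h p" using \<open>q \<in> orbit G a p\<close> by (auto simp: orbit_def)
    have "s (a g q) = \<tau> g q (s q)" if g: "g \<in> carrier G" for g
      using s[of "g \<otimes> h"] s[OF h(1)] g h p y by (simp add: a_mult transport_mult)
    then show ?thesis using s[OF h(1)] h p y transport_closed by simp
  qed
  then show ?thesis using s by blast
qed

text \<open>Infinitely many sections of finite support over single orbits can have an infinite joint support. It stays
finite if the constant section is used over all orbits that miss \<open>F\<close>, since only finitely many orbits remain.\<close>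

lemma glue_orbits:
  assumes orbitwise: "\<And>p. p \<in> P \<Longrightarrow> \<exists>s. invariant_over (orbit G a p) s"
    and F: "finite F"
    and triv: "\<And>p g. \<lbrakk>p \<in> P; orbit G a p \<inter> F = {}; g \<in> carrier G\<rbrakk> \<Longrightarrow> \<tau> g p base = base"
  shows "\<exists>x\<in>sections. \<forall>g\<in>carrier G. invariant g x"
proof -
  define S where "S Q = (if Q \<inter> F = {} then (\<lambda>_. base) else (SOME s. invariant_over Q s))" for Q
  have S: "invariant_over (orbit G a p) (S (orbit G a p))" if p: "p \<in> P" for p
  proof (cases "orbit G a p \<inter> F = {}")
    case True
    have "\<tau> g q base = base" if "q \<in> orbit G a p" "g \<in> carrier G" for g q
      using triv[of q g] True orbit_eq[OF p that(1)] orbit_subset[OF p] that by auto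
    then show ?thesis using True base by (simp add: S_def invariant_over_def)
  next
    case False
    then show ?thesis using someI_ex[OF orbitwise[OF p]] by (simp add: S_def)
  qed
  define x where "x = (\<lambda>q\<in>P. S (orbit G a q) q)"
  have inv: "invariant g x" if g: "g \<in> carrier G" for g
    unfolding invariant_def
  proof
    fix p assume p: "p \<in> P"
    have "orbit G a (a g p) = orbit G a p" by (rule orbit_eq[OF p orbitI[OF g]])
    then show "x (a g p) = \<tau> g p (x p)"
      using S[OF p] orbit_refl[OF p] g p a_closed by (simp add: x_def invariant_over_def)
  qed
  have "{p \<in> P. x p \<noteq> base} \<subseteq> (\<Union>f\<in>F \<inter> P. {q \<in> orbit G a f. S (orbit G a f) q \<noteq> base})"
  proof
    fix q assume "q \<in> {p \<in> P. x p \<noteq> base}"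
    then have q: "q \<in> P" "S (orbit G a q) q \<noteq> base" by (auto simp: x_def)
    then obtain f where f: "f \<in> orbit G a q" "f \<in> F" by (auto simp: S_def split: if_splits)
    then show "q \<in> (\<Union>f\<in>F \<inter> P. {q \<in> orbit G a f. S (orbit G a f) q \<noteq> base})"
      using q orbit_eq[OF q(1) f(1)] orbit_subset[OF q(1)] orbit_refl[OF q(1)] by auto
  qed
  moreover have "finite (\<Union>f\<in>F \<inter> P. {q \<in> orbit G a f. S (orbit G a f) q \<noteq> base})"
    using F S by (auto simp: invariant_over_def)
  ultimately have "finite {p \<in> P. x p \<noteq> base}" by (rule finite_subset)
  moreover have "x \<in> (\<Pi>\<^sub>E p\<in>P. Y)"
    using S orbit_refl by (auto simp: x_def invariant_over_def)
  ultimately show ?thesis using inv by (auto simp: restricted_power_def)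
qed

text \<open>This is the first half of decency for the action on sections. Let \<open>F\<close> be the union of the supports of the
family. Over a point outside \<open>F\<close> all members take the value \<open>base\<close>, and the family is permuted, so transport
between two such points preserves \<open>base\<close>: an orbit with such a point carries an invariant section that is
\<open>base\<close> outside \<open>F\<close>. Any other orbit lies in \<open>F\<close> and is finite, and there the values of the family form a finite
set that the stabilizer permutes.\<close>

lemma invariant_section_if_finite_invariant_family:
  assumes V: "finite V" "V \<noteq> {}" "V \<subseteq> sections"
    and perm: "\<And>g v. g \<in> carrier G \<Longrightarrow> v \<in> V \<Longrightarrow> \<exists>v'\<in>V. \<forall>p\<in>P. v' (a g p) = \<tau> g p (v p)"
  shows "\<exists>x\<in>sections. \<forall>g\<in>carrier G. invariant g x"
proof -
  define F where "F = (\<Union>v\<in>V. {p \<in> P. v p \<noteq> base})"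
  have F: "finite F" using V section_support by (auto simp: F_def)
  have off: "v q = base" if "v \<in> V" "q \<in> P" "q \<notin> F" for v q using that by (auto simp: F_def)
  obtain v where v: "v \<in> V" using V by blast
  show ?thesis
  proof (rule glue_orbits[OF _ F])
    fix p g assume p: "p \<in> P" "orbit G a p \<inter> F = {}" and g: "g \<in> carrier G"
    obtain v' where v': "v' \<in> V" "v' (a g p) = \<tau> g p (v p)" using perm[OF g v] p by blast
    have "p \<notin> F" "a g p \<notin> F" using p orbit_refl[OF p(1)] orbitI[OF g, of p] by auto
    then show "\<tau> g p base = base" using v' off[OF v p(1)] off[OF v'(1)] a_closed[OF g p(1)] by simp
  next
    fix p assume p: "p \<in> P"
    show "\<exists>s. invariant_over (orbit G a p) s"
    proof (cases "orbit G a p \<subseteq> F")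
      case False
      then obtain q where q: "q \<in> orbit G a p" "q \<notin> F" by blast
      have qP: "q \<in> P" using q orbit_subset[OF p] by blast
      have tr: "\<tau> g q base = base" if g: "g \<in> carrier G" "a g q \<notin> F" for g
      proof -
        obtain v' where v': "v' \<in> V" "v' (a g q) = \<tau> g q (v q)" using perm[OF g(1) v] qP by blast
        then show ?thesis using off[OF v qP q(2)] off[OF v'(1)] a_closed[OF g(1) qP] g(2) by simp
      qed
      have "\<tau> g q base = base" if "g \<in> stabilizer G a q" for g
        using that tr[of g] q by (auto simp: stabilizer_def)
      from invariant_extension[OF qP base this]
      obtain s where s: "\<forall>g\<in>carrier G. s (a g q) = \<tau> g q base"
        "\<forall>r\<in>orbit G a q. s r \<in> Y \<and> (\<forall>g\<in>carrier G. s (a g r) = \<tau> g r (s r))" by blast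
      have "{r \<in> orbit G a q. s r \<noteq> base} \<subseteq> F"
      proof clarify
        fix r assume r: "r \<in> orbit G a q" "s r \<noteq> base"
        then obtain g where "g \<in> carrier G" "r = a g q" by (auto simp: orbit_def)
        then show "r \<in> F" using r(2) s(1) tr[of g] by auto
      qed
      then have "finite {r \<in> orbit G a q. s r \<noteq> base}" using F finite_subset by blast
      then show ?thesis using s(2) orbit_eq[OF p q(1)] by (auto simp: invariant_over_def)
    next
      case True
      let ?K = "stabilizer G a p"
      have "(\<lambda>k. \<tau> k p (v p)) ` ?K \<subseteq> (\<lambda>v. v p) ` V"
      proof clarify
        fix k assume k: "k \<in> ?K"
        then have "k \<in> carrier G" "a k p = p" by (auto simp: stabilizer_def)
        then show "\<tau> k p (v p) \<in> (\<lambda>v. v p) ` V" using perm[OF _ v, of k] p by (metis imageI)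
      qed
      then have fin: "finite ((\<lambda>k. \<tau> k p (v p)) ` ?K)" using V finite_subset by blast
      obtain y where y: "y \<in> Y" "\<forall>k\<in>?K. \<tau> k p y = y"
        using fibre_fixed_if_finite_orbit[OF p stabilizer_subgroup[OF p] order_refl _ fin]
          section_in[OF _ p] V v by blast
      then obtain s where
        s: "\<forall>r\<in>orbit G a p. s r \<in> Y \<and> (\<forall>g\<in>carrier G. s (a g r) = \<tau> g r (s r))"
        using invariant_extension[OF p y(1)] by blast
      have "finite {r \<in> orbit G a p. s r \<noteq> base}"
        by (rule finite_subset[OF _ F]) (use True in auto)
      then show ?thesis using s by (auto simp: invariant_over_def)
    qed
  qed
qed

definition translate :: "'g \<Rightarrow> ('p \<Rightarrow> 'x) \<Rightarrow> 'p \<Rightarrow> 'x" where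
  "translate g x = (\<lambda>q\<in>P. \<tau> g (a (inv g) q) (x (a (inv g) q)))"

lemma translate_apply:
  assumes "g \<in> carrier G" "p \<in> P"
  shows "translate g x (a g p) = \<tau> g p (x p)"
  using assms by (simp add: translate_def a_closed a_inv)

lemma translate_section:
  assumes g: "g \<in> carrier G" and x: "x \<in> sections"
  shows "translate g x \<in> sections"
proof -
  have "{q \<in> P. translate g x q \<noteq> base} \<subseteq> a g ` ({p \<in> P. x p \<noteq> base} \<union> {p \<in> P. \<tau> g p base \<noteq> base})"
  proof
    fix q assume q: "q \<in> {q \<in> P. translate g x q \<noteq> base}"
    have "a (inv g) q \<in> {p \<in> P. x p \<noteq> base} \<union> {p \<in> P. \<tau> g p base \<noteq> base}"
      using q g a_closed by (auto simp: translate_def)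
    then show "q \<in> a g ` ({p \<in> P. x p \<noteq> base} \<union> {p \<in> P. \<tau> g p base \<noteq> base})"
      using a_inv(2)[OF g, of q] q by (metis (mono_tags, lifting) imageI mem_Collect_eq)
  qed
  moreover have "finite (a g ` ({p \<in> P. x p \<noteq> base} \<union> {p \<in> P. \<tau> g p base \<noteq> base}))"
    using section_support[OF x] transport_base[OF g] by simp
  ultimately have "finite {q \<in> P. translate g x q \<noteq> base}" by (rule finite_subset)
  then show ?thesis
    using g a_closed transport_closed section_in[OF x] by (auto simp: restricted_power_def translate_def)
qed

lemma translate_mult:
  assumes g: "g \<in> carrier G" and h: "h \<in> carrier G" and x: "x \<in> sections"
  shows "translate (g \<otimes> h) x = translate g (translate h x)"
proof (rule extensionalityI[of _ P])
  fix q assume q: "q \<in> P"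
  define p where "p = a (inv (g \<otimes> h)) q"
  have p: "p \<in> P" "q = a (g \<otimes> h) p" using g h q by (auto simp: p_def a_closed a_inv)
  have "translate (g \<otimes> h) x q = \<tau> (g \<otimes> h) p (x p)"
    unfolding p(2) using g h p(1) by (intro translate_apply) auto
  also have "\<dots> = \<tau> g (a h p) (translate h x (a h p))"
    using g h p(1) section_in[OF x] by (simp add: transport_mult translate_apply)
  also have "\<dots> = translate g (translate h x) q"
    unfolding p(2) using g h p(1) by (simp add: a_mult a_closed translate_apply)
  finally show "translate (g \<otimes> h) x q = translate g (translate h x) q" .
qed (simp_all add: translate_def)

lemma translate_invariant:
  assumes g: "g \<in> carrier G" and x: "x \<in> sections" and inv: "invariant g x"
  shows "translate g x = x"
proof (rule extensionalityI[of _ P])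
  show "translate g x q = x q" if "q \<in> P" for q
    using that inv g a_closed[of "inv g" q] a_inv(2)[of g q] by (auto simp: invariant_def translate_def)
qed (use x in \<open>auto simp: translate_def restricted_power_def PiE_iff\<close>)

text \<open>A section invariant under a subgroup of finite index has only finitely many translates, and the group
permutes them.\<close>

lemma invariant_section_if_finite_index:
  assumes L: "subgroup L G" "finite (rcosets L)"
    and x: "x \<in> sections" and inv: "\<And>g. g \<in> L \<Longrightarrow> invariant g x"
  shows "\<exists>x\<in>sections. \<forall>g\<in>carrier G. invariant g x"
proof -
  note Lc = subgroup.mem_carrier[OF L(1)]
  define V where "V = (\<lambda>g. translate g x) ` carrier G"
  have "V \<subseteq> (\<lambda>C. translate (inv (SOME c. c \<in> C)) x) ` (rcosets L)"
  proof (clarsimp simp: V_def)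
    fix g assume g: "g \<in> carrier G"
    define c where "c = (SOME c. c \<in> L #> inv g)"
    have "c \<in> L #> inv g"
      unfolding c_def using rcos_self[OF inv_closed[OF g] L(1)] by (rule someI)
    then obtain l where l: "l \<in> L" "c = l \<otimes> inv g" by (auto simp: r_coset_def)
    \<comment> \<open>The right coset of \<open>g\<inverse>\<close> determines the translate by \<open>g\<close>, because inversion turns it into the left coset of \<open>g\<close>.\<close>
    have "translate (inv c) x = translate (g \<otimes> inv l) x"
      using l g Lc[OF l(1)] by (simp add: inv_mult_group)
    also have "\<dots> = translate g (translate (inv l) x)"
      using g Lc[OF l(1)] x by (simp add: translate_mult)
    also have "translate (inv l) x = x"
      using l(1) Lc[OF l(1)] x inv subgroup.m_inv_closed[OF L(1)] by (simp add: translate_invariant)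
    finally show "translate g x \<in> (\<lambda>C. translate (inv (SOME c. c \<in> C)) x) ` (rcosets L)"
      using g by (intro image_eqI[of _ _ "L #> inv g"]) (auto simp: c_def RCOSETS_def)
  qed
  then have V: "finite V" using L(2) finite_surj by blast
  show ?thesis
  proof (rule invariant_section_if_finite_invariant_family[OF V])
    show "V \<noteq> {}" by (auto simp: V_def)
    show VS: "V \<subseteq> sections" using translate_section[OF _ x] by (auto simp: V_def)
    fix g v assume g: "g \<in> carrier G" and v: "v \<in> V"
    then obtain h where h: "h \<in> carrier G" "v = translate h x" by (auto simp: V_def)
    have "translate g v \<in> V"
      using g h translate_mult[OF g h(1) x] by (auto simp: V_def intro!: image_eqI[of _ _ "g \<otimes> h"])
    then show "\<exists>v'\<in>V. \<forall>p\<in>P. v' (a g p) = \<tau> g p (v p)"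
      using translate_apply[OF g] by blast
  qed
qed

lemma restrict_to_subgroup:
  assumes L: "subgroup L G"
  shows "bundle_action (G\<lparr>carrier := L\<rparr>) P a Y base \<tau>"
proof -
  have sub: "subgroup K G" if "subgroup K (G\<lparr>carrier := L\<rparr>)" for K
    by (rule incl_subgroup[OF L that])
  have st: "K \<subseteq> stabilizer G a p" if "K \<subseteq> stabilizer (G\<lparr>carrier := L\<rparr>) a p" for K p
    using that subgroup.subset[OF L] by (auto simp: stabilizer_def)
  show ?thesis
  proof (intro bundle_action.intro bundle_action_axioms.intro)
    show "group_action (G\<lparr>carrier := L\<rparr>) P a" by (rule induced_action[OF L])
    show "\<exists>y\<in>Y. \<forall>k\<in>K. \<tau> k p y = y"
      if "p \<in> P" "subgroup K (G\<lparr>carrier := L\<rparr>)" "K \<subseteq> stabilizer (G\<lparr>carrier := L\<rparr>) a p" "y \<in> Y"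
        "finite ((\<lambda>k. \<tau> k p y) ` K)" for p K y
      by (rule fibre_fixed_if_finite_orbit[OF that(1) sub[OF that(2)] st[OF that(3)] that(4,5)])
    show "\<exists>y\<in>Y. \<forall>k\<in>K. \<tau> k p y = y"
      if "p \<in> P" "subgroup K (G\<lparr>carrier := L\<rparr>)" "K \<subseteq> stabilizer (G\<lparr>carrier := L\<rparr>) a p"
        "finitely_generated (G\<lparr>carrier := L, carrier := K\<rparr>)" "\<forall>k\<in>K. \<exists>y\<in>Y. \<tau> k p y = y" for p K
      by (rule fibre_fixed_if_elliptic[OF that(1) sub[OF that(2)] st[OF that(3)] _ that(5)])
        (use that(4) in simp)
  qed (use base transport_closed transport_one transport_mult transport_base subgroup.mem_carrier[OF L] in auto)
qed

text \<open>The stabilizer of a point has finite index, so it is again finitely generated, and the invariant sections of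
its elements provide fixed points in the fibre.\<close>

lemma invariant_over_finite_orbit:
  assumes fg: "finitely_generated G"
    and ell: "\<forall>g\<in>carrier G. \<exists>x\<in>sections. invariant g x"
    and p: "p \<in> P" and fin: "finite (orbit G a p)"
  shows "\<exists>s. invariant_over (orbit G a p) s"
proof -
  let ?K = "stabilizer G a p"
  have K: "subgroup ?K G" by (rule stabilizer_subgroup[OF p])
  have "finite (rcosets ?K)"
    using bij_betw_finite[OF orbit_stab_fun_is_bij[OF p]] fin by simp
  then have fgK: "finitely_generated (G\<lparr>carrier := ?K\<rparr>)"
    by (rule finitely_generated_finite_index[OF fg K])
  have "\<exists>y\<in>Y. \<tau> k p y = y" if k: "k \<in> ?K" for k
  proof -
    have k': "k \<in> carrier G" "a k p = p" using k by (auto simp: stabilizer_def)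
    obtain x where x: "x \<in> sections" "invariant k x" using ell k'(1) by blast
    then have "\<tau> k p (x p) = x p" using p k'(2) by (auto simp: invariant_def)
    then show ?thesis using section_in[OF x(1) p] by blast
  qed
  then obtain y where y: "y \<in> Y" "\<forall>k\<in>?K. \<tau> k p y = y"
    using fibre_fixed_if_elliptic[OF p K order_refl fgK] by blast
  then obtain s where "\<forall>r\<in>orbit G a p. s r \<in> Y \<and> (\<forall>g\<in>carrier G. s (a g r) = \<tau> g r (s r))"
    using invariant_extension[OF p y(1)] by blast
  then show ?thesis using fin by (auto simp: invariant_over_def)
qed


section \<open>Infinite orbits under a nilpotent group\<close>

lemma finite_along_line:
  assumes "inj r" "range r \<subseteq> P" "finite {p \<in> P. Q p}"
  shows "finite {n. Q (r n)}"
proof -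
  have "{n. Q (r n)} = r -` {p \<in> P. Q p}" using assms(2) by auto
  then show ?thesis using finite_vimageI[OF assms(3,1)] by simp
qed

lemma invariant_subgroup:
  assumes x: "x \<in> sections"
  shows "subgroup {g \<in> carrier G. invariant g x} G"
proof (rule subgroupI)
  show "{g \<in> carrier G. invariant g x} \<noteq> {}"
    using section_in[OF x] by (intro ex_in_conv[THEN iffD1] exI[of _ \<one>]) (simp add: invariant_def a_one transport_one)
  fix g assume g: "g \<in> {g \<in> carrier G. invariant g x}"
  have "x (a (inv g) p) = \<tau> (inv g) p (x p)" if p: "p \<in> P" for p
  proof -
    have q: "a (inv g) p \<in> P" using g p a_closed by simp
    have "x p = \<tau> g (a (inv g) p) (x (a (inv g) p))"
      using g q p a_inv(2)[of g p] by (auto simp: invariant_def)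
    then show ?thesis
      using transport_inv[of g "a (inv g) p" "x (a (inv g) p)"] g q p section_in[OF x] a_inv(2)[of g p] by simp
  qed
  then show "inv g \<in> {g \<in> carrier G. invariant g x}" using g by (simp add: invariant_def)
  fix h assume h: "h \<in> {g \<in> carrier G. invariant g x}"
  show "g \<otimes> h \<in> {g \<in> carrier G. invariant g x}"
    using g h section_in[OF x] by (simp add: invariant_def a_mult a_closed transport_mult)
qed auto

text \<open>The points \<open>r j\<close> form a line along which \<open>Z\<close> shifts, while \<open>g\<close> fixes each of them and acts nontrivially on the
values of \<open>x\<close> only over \<open>r 0\<close>. The section \<open>w\<close> is invariant under \<open>Z g\<close> and equals \<open>base\<close> near both ends of the
line. Coming from \<open>-\<infinity>\<close> it must agree with \<open>x\<close> up to and including \<open>r 0\<close>, as \<open>Z g\<close> transports like \<open>Z\<close> before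
that point; coming from \<open>+\<infinity>\<close> it must agree with \<open>x\<close> down to \<open>r 1\<close>. The step from \<open>r 0\<close> to \<open>r 1\<close> then leaves
\<open>\<tau> g (r 0)\<close> no choice but to fix \<open>x (r 0)\<close>.\<close>

lemma value_fixed_on_line:
  fixes r :: "int \<Rightarrow> 'p"
  assumes Z: "Z \<in> carrier G" and g: "g \<in> carrier G"
    and r: "inj r" "range r \<subseteq> P" "\<And>j. a Z (r j) = r (j + 1)" "\<And>j. a g (r j) = r j"
    and x: "x \<in> sections" "invariant Z x" and w: "w \<in> sections" "invariant (Z \<otimes> g) w"
    and off: "\<And>j. j \<noteq> 0 \<Longrightarrow> x (r j) = base" "\<And>j. j \<noteq> 0 \<Longrightarrow> \<tau> g (r j) base = base"
  shows "\<tau> g (r 0) (x (r 0)) = x (r 0)"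
proof -
  have rP: "r j \<in> P" for j using r(2) by auto
  have xY: "x (r j) \<in> Y" and wY: "w (r j) \<in> Y" for j using section_in x w rP by auto
  have gY: "\<tau> g (r j) y \<in> Y" if "y \<in> Y" for j y using transport_closed[OF g rP that] .
  have xs: "x (r (j + 1)) = \<tau> Z (r j) (x (r j))" for j
    using x(2) rP[of j] r(3)[of j] by (auto simp: invariant_def)
  have ws: "w (r (j + 1)) = \<tau> Z (r j) (\<tau> g (r j) (w (r j)))" for j
  proof -
    have "a (Z \<otimes> g) (r j) = r (j + 1)" using Z g rP r(3,4) by (simp add: a_mult)
    then have "w (r (j + 1)) = \<tau> (Z \<otimes> g) (r j) (w (r j))" using w(2) rP[of j] by (auto simp: invariant_def)
    then show ?thesis using Z g rP wY r(4) by (simp add: transport_mult)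
  qed
  have "finite {j. w (r j) \<noteq> base}" by (rule finite_along_line[OF r(1,2) section_support[OF w(1)]])
  then obtain N :: nat where N: "N > 0" "\<And>j. \<bar>j\<bar> \<ge> int N \<Longrightarrow> w (r j) = base"
    using int_set_bounded by (metis (mono_tags, lifting) linorder_not_le mem_Collect_eq)
  have bwd: "w (r (- int n)) = x (r (- int n))" for n
  proof (rule inc_induct[of n "n + N" "\<lambda>n. w (r (- int n)) = x (r (- int n))"])
    show "w (r (- int (n + N))) = x (r (- int (n + N)))" using N off(1) by simp
  next
    fix m assume IH: "w (r (- int (Suc m))) = x (r (- int (Suc m)))"
    have e: "- int (Suc m) + 1 = - int m" by simp
    have b: "x (r (- int (Suc m))) = base" "\<tau> g (r (- int (Suc m))) base = base" by (rule off; simp)+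
    show "w (r (- int m)) = x (r (- int m))"
      using xs[of "- int (Suc m)"] ws[of "- int (Suc m)"] IH b unfolding e by simp
  qed simp
  have fwd: "w (r (int n + 1)) = x (r (int n + 1))" for n
  proof (rule inc_induct[of n "n + N" "\<lambda>n. w (r (int n + 1)) = x (r (int n + 1))"])
    show "w (r (int (n + N) + 1)) = x (r (int (n + N) + 1))" using N off(1) by simp
  next
    fix m assume IH: "w (r (int (Suc m) + 1)) = x (r (int (Suc m) + 1))"
    define j where "j = int m + 1"
    have b: "x (r j) = base" "\<tau> g (r j) base = base" by (rule off; simp add: j_def)+
    have "w (r (j + 1)) = x (r (j + 1))" using IH by (simp add: j_def add.commute add.left_commute)
    then have "\<tau> Z (r j) (\<tau> g (r j) (w (r j))) = \<tau> Z (r j) (x (r j))" using xs ws by simp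
    then have "\<tau> g (r j) (w (r j)) = x (r j)" by (rule transport_inj[OF Z rP gY[OF wY] xY])
    then have "\<tau> g (r j) (w (r j)) = \<tau> g (r j) base" using b by simp
    then have "w (r j) = base" by (rule transport_inj[OF g rP wY base])
    then show "w (r (int m + 1)) = x (r (int m + 1))" using b by (simp add: j_def)
  qed simp
  have "\<tau> Z (r 0) (\<tau> g (r 0) (x (r 0))) = \<tau> Z (r 0) (x (r 0))"
    using bwd[of 0] fwd[of 0] xs[of 0] ws[of 0] by simp
  then show ?thesis by (rule transport_inj[OF Z rP gY[OF xY] xY])
qed

text \<open>Along the line through \<open>q\<close> the values of \<open>x\<close> differ from \<open>base\<close> at finitely many points only, and \<open>g\<close> moves \<open>base\<close>
over finitely many points only. A sufficiently high power \<open>Z = z\<^sup>N\<close> jumps over all of them except possibly \<open>q\<close>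
itself, so that \<open>value_fixed_on_line\<close> applies to \<open>Z\<close>.\<close>

lemma value_fixed_by_stabilizer:
  assumes ell: "\<forall>g\<in>carrier G. \<exists>x\<in>sections. invariant g x"
    and z: "z \<in> carrier G" and x: "x \<in> sections" "invariant z x"
    and q: "q \<in> P" and inj: "inj (\<lambda>n::int. a (z [^] n) q)"
    and g: "g \<in> carrier G" "\<And>n::int. a g (a (z [^] n) q) = a (z [^] n) q"
  shows "\<tau> g q (x q) = x q"
proof -
  let ?l = "\<lambda>n::int. a (z [^] n) q"
  have l: "range ?l \<subseteq> P" using z q a_closed by auto
  have "finite ({n. x (?l n) \<noteq> base} \<union> {n. \<tau> g (?l n) base \<noteq> base})"
    using finite_along_line[OF inj l section_support[OF x(1)]]
      finite_along_line[OF inj l transport_base[OF g(1)]] by simp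
  then obtain N :: nat where N: "N > 0"
    "\<forall>n\<in>{n. x (?l n) \<noteq> base} \<union> {n. \<tau> g (?l n) base \<noteq> base}. \<bar>n\<bar> < int N"
    using int_set_bounded by blast
  define Z where "Z = z [^] int N"
  define r where "r j = ?l (j * int N)" for j
  have far: "int N \<le> \<bar>j * int N\<bar>" if "j \<noteq> 0" for j
    using that mult_right_mono[of 1 "\<bar>j\<bar>" "int N"] by (simp add: abs_mult)
  have Zc: "Z \<in> carrier G" using z by (simp add: Z_def)
  have Zx: "invariant Z x"
    using subgroup_int_pow_closed[OF invariant_subgroup[OF x(1)], of z "int N"] z x by (simp add: Z_def)
  obtain w where w: "w \<in> sections" "invariant (Z \<otimes> g) w" using ell Zc g(1) m_closed by blast
  have "\<tau> g (r 0) (x (r 0)) = x (r 0)"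
  proof (rule value_fixed_on_line[OF Zc g(1) _ _ _ _ x(1) Zx w])
    show "inj r"
    proof (rule injI)
      fix i j assume "r i = r j"
      then have "i * int N = j * int N" unfolding r_def by (rule injD[OF inj])
      then show "i = j" using N(1) by simp
    qed
    show "range r \<subseteq> P" using l by (auto simp: r_def)
    show "a Z (r j) = r (j + 1)" for j
    proof -
      have "a Z (r j) = a (Z \<otimes> z [^] (j * int N)) q"
        using z q Zc by (simp add: r_def a_mult)
      also have "Z \<otimes> z [^] (j * int N) = z [^] ((j + 1) * int N)"
        unfolding Z_def using z by (simp add: int_pow_mult[symmetric] algebra_simps)
      finally show ?thesis by (simp add: r_def)
    qed
    show "a g (r j) = r j" for j using g(2) by (simp add: r_def)
    show "x (r j) = base" "\<tau> g (r j) base = base" if "j \<noteq> 0" for j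
      using N(2) far[OF that] by (force simp: r_def)+
  qed
  then show ?thesis using q by (simp add: r_def a_one)
qed

text \<open>The image of \<open>G\<close> in the group of permutations of the orbit is nilpotent, and it is infinite because it is
transitive on an infinite set. So it has a central element of infinite order. A power of it that fixes one point
of the orbit fixes all of them, by centrality and transitivity, and is therefore trivial.\<close>

lemma central_translation:
  assumes fg: "finitely_generated G"
    and nil: "\<forall>g\<in>lower_central G c. \<forall>p\<in>P. a g p = p"
    and p: "p \<in> P" and inf: "infinite (orbit G a p)"
  shows "\<exists>z\<in>carrier G.
    (\<forall>g\<in>carrier G. \<forall>q\<in>orbit G a p. \<forall>n::int. a g (a (z [^] n) q) = a (z [^] n) (a g q)) \<and>
    (\<forall>q\<in>orbit G a p. inj (\<lambda>n::int. a (z [^] n) q))"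
proof -
  let ?O = "orbit G a p"
  define \<theta> where "\<theta> g = restrict (a g) ?O" for g
  note OP = subsetD[OF orbit_subset[OF p]]
  have Ocl: "a g q \<in> ?O" if "g \<in> carrier G" "q \<in> ?O" for g q
    using orbitI[OF that(1), of q] orbit_eq[OF p that(2)] by simp
  have act: "group_action G ?O \<theta>"
    by (rule group_actionI) (use Ocl OP a_one a_mult is_group in \<open>auto simp: \<theta>_def\<close>)
  interpret B: group_hom G "BijGroup ?O" \<theta> using act by (simp add: group_action_def)
  let ?K = "(BijGroup ?O)\<lparr>carrier := \<theta> ` carrier G\<rparr>"
  interpret K: group ?K
    by (rule subgroup.subgroup_is_group[OF B.img_is_subgroup group_BijGroup])
  interpret h: group_hom G ?K \<theta>
    by unfold_locales (auto simp: hom_def)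
  have \<theta>1: "\<theta> g = \<one>\<^bsub>?K\<^esub>" if "g \<in> carrier G" "\<And>q. q \<in> ?O \<Longrightarrow> a g q = q" for g
  proof -
    have "\<theta> g = \<theta> \<one>" unfolding \<theta>_def using that OP a_one by (intro restrict_ext) auto
    then show ?thesis by simp
  qed
  have lc: "subgroup (lower_central G c) G" by (rule normal_imp_subgroup[OF lower_central_normal])
  have "\<theta> ` lower_central G c = {\<one>\<^bsub>?K\<^esub>}"
  proof
    show "\<theta> ` lower_central G c \<subseteq> {\<one>\<^bsub>?K\<^esub>}"
      using \<theta>1 nil OP subgroup.mem_carrier[OF lc] by blast
    show "{\<one>\<^bsub>?K\<^esub>} \<subseteq> \<theta> ` lower_central G c"
      using subgroup.one_closed[OF lc] h.hom_one by (metis empty_subsetI image_eqI insert_subset)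
  qed
  then have nilK: "lower_central ?K c = {\<one>\<^bsub>?K\<^esub>}"
    using h.lower_central_image by simp
  have "?O \<subseteq> (\<lambda>f. f p) ` carrier ?K"
    using orbit_refl[OF p] by (auto simp: orbit_def \<theta>_def image_image)
  then have infK: "infinite (carrier ?K)" using inf finite_surj by blast
  obtain z' where z': "z' \<in> carrier ?K" "\<forall>k\<in>carrier ?K. z' \<otimes>\<^bsub>?K\<^esub> k = k \<otimes>\<^bsub>?K\<^esub> z'"
    "\<forall>n>0::nat. z' [^]\<^bsub>?K\<^esub> n \<noteq> \<one>\<^bsub>?K\<^esub>"
    using K.nilpotent_central_element_infinite_order[OF B.finitely_generated_image[OF fg] infK nilK] by blast
  obtain z where z: "z \<in> carrier G" "z' = \<theta> z" using z'(1) by auto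
  have comm: "a g (a (z [^] n) q) = a (z [^] n) (a g q)"
    if g: "g \<in> carrier G" and q: "q \<in> ?O" for g q and n :: nat
  proof -
    have "\<theta> (z [^] n) \<otimes>\<^bsub>?K\<^esub> \<theta> g = \<theta> g \<otimes>\<^bsub>?K\<^esub> \<theta> (z [^] n)"
      using K.group_commutes_pow[of z' "\<theta> g" n] z' z g h.hom_nat_pow by auto
    then have "\<theta> (z [^] n \<otimes> g) = \<theta> (g \<otimes> z [^] n)" using z g by simp
    then have "a (z [^] n \<otimes> g) q = a (g \<otimes> z [^] n) q"
      using q unfolding \<theta>_def by (metis restrict_apply')
    then show ?thesis using z g OP[OF q] by (simp add: a_mult)
  qed
  have commi: "a g (a (z [^] n) q) = a (z [^] n) (a g q)"
    if g: "g \<in> carrier G" and q: "q \<in> ?O" for g q and n :: int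
  proof (cases "n \<ge> 0")
    case True
    then obtain m where m: "n = int m" by (rule nonneg_int_cases[of n])
    show ?thesis unfolding m int_pow_int by (rule comm[OF g q])
  next
    case False
    then obtain m where m: "n = - int m" using nonpos_int_cases[of n] by auto
    define u where "u = z [^] m"
    have u: "u \<in> carrier G" "z [^] n = inv u"
      using z int_pow_neg_int[OF z(1), of m] by (simp_all add: u_def m)
    have q': "a (inv u) q \<in> ?O" using Ocl u q by simp
    have "a u (a g (a (inv u) q)) = a g (a u (a (inv u) q))"
      unfolding u_def by (rule comm[OF g q'[unfolded u_def], symmetric])
    also have "\<dots> = a g q" using a_inv(2)[OF u(1) OP[OF q]] by simp
    finally have "a u (a g (a (inv u) q)) = a g q" .
    then have "a (inv u) (a g q) = a g (a (inv u) q)"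
      using a_inv(1)[OF u(1), of "a g (a (inv u) q)"] a_closed g OP[OF q'] by simp
    then show ?thesis using u by simp
  qed
  have free: "a (z [^] n) q \<noteq> q" if q: "q \<in> ?O" and n: "n > 0" for q and n :: nat
  proof
    assume fixq: "a (z [^] n) q = q"
    have "a (z [^] n) r = r" if r: "r \<in> ?O" for r
    proof -
      obtain g where g: "g \<in> carrier G" "r = a g q" using r orbit_eq[OF p q] by (auto simp: orbit_def)
      then show ?thesis using comm[OF g(1) q, of n] fixq by simp
    qed
    then have "\<theta> (z [^] n) = \<one>\<^bsub>?K\<^esub>" using \<theta>1 z by simp
    then show False using z'(3) n z h.hom_nat_pow by auto
  qed
  have ordered: "a (z [^] n) q \<noteq> a (z [^] m) q" if q: "q \<in> ?O" and nm: "n < m" for q and n m :: int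
  proof
    assume e: "a (z [^] n) q = a (z [^] m) q"
    have "a (z [^] m) q = a (z [^] (m - n)) (a (z [^] n) q)"
      using z OP[OF q] by (simp add: a_mult[symmetric] int_pow_mult[symmetric])
    moreover obtain k where k: "m - n = int k" using nm nonneg_int_cases[of "m - n"] by auto
    ultimately have "a (z [^] k) (a (z [^] n) q) = a (z [^] n) q"
      using e by (metis int_pow_int)
    then show False using free[of "a (z [^] n) q" k] Ocl z q nm k by simp
  qed
  then have "inj (\<lambda>n::int. a (z [^] n) q)" if "q \<in> ?O" for q
    using that by (intro injI) (metis linorder_neqE)
  then show ?thesis using z(1) commi by blast
qed

text \<open>Let \<open>x\<close> be a section invariant under a central translation \<open>z\<close>; over the orbit it turns out to be
invariant under every \<open>g\<close>. To compare \<open>\<tau> g q (x q)\<close> with \<open>x (a g q)\<close>, move along the two lines by a power \<open>u\<close> of \<open>z\<close> so far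
that both values are \<open>base\<close> and \<open>g\<close> preserves \<open>base\<close>. Moving back requires to exchange \<open>g\<close> and \<open>u\<close>. They commute only
on the orbit, not in \<open>G\<close>: the discrepancy \<open>k\<close> stabilizes \<open>q\<close>, so by \<open>value_fixed_by_stabilizer\<close> it
does no harm to the value \<open>x q\<close>.\<close>

lemma invariant_over_infinite_orbit:
  assumes fg: "finitely_generated G"
    and ell: "\<forall>g\<in>carrier G. \<exists>x\<in>sections. invariant g x"
    and nil: "\<forall>g\<in>lower_central G c. \<forall>p\<in>P. a g p = p"
    and p: "p \<in> P" and inf: "infinite (orbit G a p)"
  shows "\<exists>s. invariant_over (orbit G a p) s"
proof -
  let ?O = "orbit G a p"
  note OP = subsetD[OF orbit_subset[OF p]]
  have Ocl: "a g q \<in> ?O" if "g \<in> carrier G" "q \<in> ?O" for g q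
    using orbitI[OF that(1), of q] orbit_eq[OF p that(2)] by simp
  obtain z where z: "z \<in> carrier G"
    and comm': "\<forall>g\<in>carrier G. \<forall>q\<in>?O. \<forall>n::int. a g (a (z [^] n) q) = a (z [^] n) (a g q)"
    and inj': "\<forall>q\<in>?O. inj (\<lambda>n::int. a (z [^] n) q)"
    using central_translation[OF fg nil p inf] by (elim bexE conjE) (rule that)
  have comm: "a g (a (z [^] n) q) = a (z [^] n) (a g q)"
    if "g \<in> carrier G" "q \<in> ?O" for g q and n :: int
    using comm'[rule_format, OF that] .
  have inj: "inj (\<lambda>n::int. a (z [^] n) q)" if "q \<in> ?O" for q
    using inj'[rule_format, OF that] .
  obtain x where x: "x \<in> sections" "invariant z x" using ell z by blast
  have stab: "\<tau> k q (x q) = x q" if "q \<in> ?O" "k \<in> carrier G" "a k q = q" for k q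
  proof (rule value_fixed_by_stabilizer[OF ell z x OP[OF that(1)] inj[OF that(1)] that(2)])
    show "a k (a (z [^] n) q) = a (z [^] n) q" for n :: int
      using comm[OF that(2,1), of n] unfolding that(3) .
  qed
  have "x (a g q) = \<tau> g q (x q)" if q: "q \<in> ?O" and g: "g \<in> carrier G" for g q
  proof -
    define q' where "q' = a g q"
    have q': "q' \<in> ?O" using Ocl g q by (simp add: q'_def)
    note P = OP[OF q] OP[OF q']
    have line: "range (\<lambda>n::int. a (z [^] n) r) \<subseteq> P" if "r \<in> P" for r
      using that z a_closed by auto
    have fin: "finite ({n::int. x (a (z [^] n) q) \<noteq> base} \<union> {n. \<tau> g (a (z [^] n) q) base \<noteq> base}
        \<union> {n. x (a (z [^] n) q') \<noteq> base})"
      using finite_along_line[OF inj[OF q] line[OF P(1)] section_support[OF x(1)]]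
        finite_along_line[OF inj[OF q] line[OF P(1)] transport_base[OF g]]
        finite_along_line[OF inj[OF q'] line[OF P(2)] section_support[OF x(1)]] by simp
    obtain n :: int where "n \<notin> {n. x (a (z [^] n) q) \<noteq> base} \<union> {n. \<tau> g (a (z [^] n) q) base \<noteq> base}
        \<union> {n. x (a (z [^] n) q') \<noteq> base}"
      using ex_new_if_finite[OF infinite_UNIV_int fin] by (elim exE) (rule that)
    then have n: "x (a (z [^] n) q) = base" "\<tau> g (a (z [^] n) q) base = base"
      "x (a (z [^] n) q') = base" by simp_all
    define u where "u = z [^] n"
    have u: "u \<in> carrier G" "invariant u x"
      using z subgroup_int_pow_closed[OF invariant_subgroup[OF x(1)], of z n] x by (auto simp: u_def)
    define k where "k = inv (u \<otimes> g) \<otimes> (g \<otimes> u)"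
    have k: "k \<in> carrier G" "(u \<otimes> g) \<otimes> k = g \<otimes> u" using u(1) g by (auto simp: k_def cancel_left)
    have "a (g \<otimes> u) q = a g (a u q)" using u(1) g P by (simp add: a_mult)
    also have "\<dots> = a u (a g q)" unfolding u_def by (rule comm[OF g q])
    also have "\<dots> = a (u \<otimes> g) q" using u(1) g P by (simp add: a_mult)
    finally have "a (g \<otimes> u) q = a (u \<otimes> g) q" .
    moreover have "a k q = a (inv (u \<otimes> g)) (a (g \<otimes> u) q)"
      using u(1) g P by (simp only: k_def a_mult inv_closed m_closed)
    ultimately have kq: "a k q = q" using a_inv(1)[of "u \<otimes> g" q] u(1) g P by simp
    have Y: "x q \<in> Y" "x q' \<in> Y" using section_in[OF x(1)] P by auto
    have "\<tau> u q' (\<tau> g q (x q)) = \<tau> (u \<otimes> g) q (x q)"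
      using u(1) g P Y by (simp add: transport_mult q'_def)
    also have "\<dots> = \<tau> (u \<otimes> g) (a k q) (\<tau> k q (x q))"
      using kq stab[OF q k(1) kq] by simp
    also have "\<dots> = \<tau> (g \<otimes> u) q (x q)"
      unfolding k(2)[symmetric] using u(1) g k(1) P Y by (subst transport_mult[of "u \<otimes> g" k]) auto
    also have "\<dots> = \<tau> g (a u q) (\<tau> u q (x q))"
      using u(1) g P Y by (simp add: transport_mult)
    also have "\<tau> u q (x q) = x (a u q)" using u(2) P by (auto simp: invariant_def)
    also have "\<tau> g (a u q) (x (a u q)) = x (a u q')" using n by (simp add: u_def)
    also have "\<dots> = \<tau> u q' (x q')" using u(2) P by (auto simp: invariant_def)
    finally have "\<tau> g q (x q) = x q'"
      by (rule transport_inj[OF u(1) P(2) transport_closed[OF g P(1) Y(1)] Y(2)])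
    then show ?thesis by (simp add: q'_def)
  qed
  moreover have "finite {q \<in> ?O. x q \<noteq> base}"
    by (rule finite_subset[OF _ section_support[OF x(1)]]) (use OP in auto)
  ultimately show ?thesis
    using section_in[OF x(1)] OP unfolding invariant_over_def by (intro exI[of _ x]) blast
qed

text \<open>Each generator moves the constant section over finitely many points only. Orbits that avoid all these points
carry the constant section, which takes care of all but finitely many orbits.\<close>

lemma invariant_section_if_nilpotent:
  assumes fg: "finitely_generated G"
    and ell: "\<forall>g\<in>carrier G. \<exists>x\<in>sections. invariant g x"
    and nil: "\<forall>g\<in>lower_central G c. \<forall>p\<in>P. a g p = p"
  shows "\<exists>x\<in>sections. \<forall>g\<in>carrier G. invariant g x"
proof -
  obtain S where S: "finite S" "S \<subseteq> carrier G" "generate G S = carrier G"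
    using fg by (auto simp: finitely_generated_def)
  define F where "F = (\<Union>s\<in>S. {p \<in> P. \<tau> s p base \<noteq> base})"
  show ?thesis
  proof (rule glue_orbits)
    show "finite F" using S transport_base by (auto simp: F_def)
    show "\<exists>s. invariant_over (orbit G a p) s" if "p \<in> P" for p
      using invariant_over_finite_orbit[OF fg ell that] invariant_over_infinite_orbit[OF fg ell nil that] by blast
    fix p g assume p: "p \<in> P" and F: "orbit G a p \<inter> F = {}" and g: "g \<in> carrier G"
    have gen: "g \<in> generate G S" using S g by simp
    then have "g \<in> carrier G \<and> (\<forall>q\<in>orbit G a p. a g q \<in> orbit G a p \<and> \<tau> g q base = base)"
    proof induction
      case one
      then show ?case using orbit_subset[OF p] a_one transport_one base by auto
    next
      case (incl s)
      then show ?case using F S orbit_subset[OF p] orbitI[of s] orbit_eq[OF p]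
        by (fastforce simp: F_def)
    next
      case (inv s)
      have s: "s \<in> carrier G" using inv S by auto
      have "a (inv s) q \<in> orbit G a p \<and> \<tau> (inv s) q base = base" if q: "q \<in> orbit G a p" for q
      proof -
        have q': "a (inv s) q \<in> orbit G a p" using orbitI[of "inv s" q] orbit_eq[OF p q] s by simp
        then have "\<tau> s (a (inv s) q) base = base" using F inv orbit_subset[OF p] by (auto simp: F_def)
        then show ?thesis
          using transport_inv[OF s subsetD[OF orbit_subset[OF p] q'] base]
            a_inv(2)[OF s subsetD[OF orbit_subset[OF p] q]] q' by simp
      qed
      then show ?case using s by simp
    next
      case (eng g h)
      then show ?case using orbit_subset[OF p] base by (auto simp: a_mult transport_mult subset_iff)
    qed
    then show "\<tau> g p base = base" using orbit_refl[OF p] by blast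
  qed
qed

lemma invariant_section_if_virtually_nilpotent:
  assumes fg: "finitely_generated G"
    and ell: "\<forall>g\<in>carrier G. \<exists>x\<in>sections. invariant g x"
    and L: "subgroup L G" "finite (rcosets L)"
    and nil: "\<forall>g\<in>lower_central (G\<lparr>carrier := L\<rparr>) c. \<forall>p\<in>P. a g p = p"
  shows "\<exists>x\<in>sections. \<forall>g\<in>carrier G. invariant g x"
proof -
  interpret L: bundle_action "G\<lparr>carrier := L\<rparr>" P a Y base \<tau> by (rule restrict_to_subgroup[OF L(1)])
  have "\<exists>x\<in>sections. \<forall>g\<in>carrier (G\<lparr>carrier := L\<rparr>). invariant g x"
    by (rule L.invariant_section_if_nilpotent[OF finitely_generated_finite_index[OF fg L] _ nil])
       (use ell subgroup.mem_carrier[OF L(1)] in auto)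
  then show ?thesis using invariant_section_if_finite_index[OF L] by auto
qed

end


section \<open>Wreath products\<close>

text \<open>The formula \<open>(g h x)\<^sub>p = g\<^sub>p x\<^bsub>h\<inverse>p\<^esub>\<close> for \<open>\<gamma> = g h\<close>, read at the point \<open>h p\<close> instead of \<open>p\<close>.\<close>

abbreviation wreath_transport ::
  "('h \<Rightarrow> 'p \<Rightarrow> 'p) \<Rightarrow> ('g \<Rightarrow> 'x \<Rightarrow> 'x) \<Rightarrow> ('p \<Rightarrow> 'g) \<times> 'h \<Rightarrow> 'p \<Rightarrow> 'x \<Rightarrow> 'x" where
  "wreath_transport \<psi> \<phi> \<gamma> p y \<equiv> \<phi> (fst \<gamma> (\<psi> (snd \<gamma>) p)) y"

text \<open>The stabilizer of \<open>p\<close> acts on the fibre over \<open>p\<close> through evaluation of the first component at \<open>p\<close>, which is a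
homomorphism to \<open>G\<^sub>0\<close> on that stabilizer. This is how decency of the action of \<open>G\<^sub>0\<close> enters.\<close>

lemma wreath_bundle_action:
  fixes G\<^sub>0 :: "('g, 'm) monoid_scheme" and H :: "('h, 'n) monoid_scheme"
  assumes dec: "decent_action G\<^sub>0 X\<^sub>0 \<phi>" and x\<^sub>0: "x\<^sub>0 \<in> X\<^sub>0" and act: "group_action H P \<psi>"
    and \<Gamma>: "subgroup \<Gamma> (G_oplus G\<^sub>0 H P \<psi> X\<^sub>0 \<phi> x\<^sub>0)"
  shows "bundle_action ((G_oplus G\<^sub>0 H P \<psi> X\<^sub>0 \<phi> x\<^sub>0)\<lparr>carrier := \<Gamma>\<rparr>) P (\<lambda>\<gamma>. \<psi> (snd \<gamma>)) X\<^sub>0 x\<^sub>0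
    (wreath_transport \<psi> \<phi>)"
proof -
  let ?D = "G_oplus G\<^sub>0 H P \<psi> X\<^sub>0 \<phi> x\<^sub>0"
  let ?G = "?D\<lparr>carrier := \<Gamma>\<rparr>"
  have actG: "group_action G\<^sub>0 X\<^sub>0 \<phi>" using dec by (simp add: decent_action_def)
  interpret H: group H by (rule group_action_group[OF act])
  interpret G0: group G\<^sub>0 by (rule group_action_group[OF actG])
  have grpD: "group ?D" by (rule group_action_group[OF G_oplus_group_action[OF actG act]])
  interpret G: group ?G by (rule subgroup.subgroup_is_group[OF \<Gamma> grpD])
  have mem: "fst g \<in> (\<Pi>\<^sub>E p\<in>P. carrier G\<^sub>0)" "snd g \<in> carrier H" if "g \<in> \<Gamma>" for g
  proof -
    have "g \<in> (\<Pi>\<^sub>E p\<in>P. carrier G\<^sub>0) \<times> carrier H"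
      using subgroup.mem_carrier[OF \<Gamma> that] by (auto simp: G_oplus_def wreath_product_def)
    then show "fst g \<in> (\<Pi>\<^sub>E p\<in>P. carrier G\<^sub>0)" "snd g \<in> carrier H"
      by (simp_all add: mem_Times_iff)
  qed
  have fstc: "fst g p \<in> carrier G\<^sub>0" if "g \<in> \<Gamma>" "p \<in> P" for g p using mem(1)[OF that(1)] that(2) by auto
  have mult: "g \<otimes>\<^bsub>?G\<^esub> h = ((\<lambda>p\<in>P. fst g p \<otimes>\<^bsub>G\<^sub>0\<^esub> fst h (\<psi> (inv\<^bsub>H\<^esub> snd g) p)), snd g \<otimes>\<^bsub>H\<^esub> snd h)" for g h
    by (cases g; cases h) (auto simp: G_oplus_def wreath_product_def shift_def)
  have one: "\<one>\<^bsub>?G\<^esub> = ((\<lambda>p\<in>P. \<one>\<^bsub>G\<^sub>0\<^esub>), \<one>\<^bsub>H\<^esub>)"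
    by (simp add: G_oplus_def wreath_product_def)
  have cl: "\<psi> h p \<in> P" if "h \<in> carrier H" "p \<in> P" for h p using group_action_closed[OF act that] .
  note comp = group_action_comp[OF act] and comp0 = group_action_comp[OF actG]
  note cl0 = group_action_closed[OF actG]
  have actP: "group_action ?G P (\<lambda>\<gamma>. \<psi> (snd \<gamma>))"
  proof (rule group_actionI)
    show "\<psi> (snd g) \<in> extensional P" if "g \<in> carrier ?G" for g
      using group_action.bij_prop0[OF act] mem(2)[of g] that by (simp add: Bij_def)
  qed (use G.is_group mem(2) cl comp mult one group_action_one[OF act] in \<open>auto\<close>)
  \<comment> \<open>Evaluation at \<open>p\<close> transfers subgroups of the stabilizer, and their finite generation, to \<open>G\<^sub>0\<close>.\<close>
  have fibre: "\<exists>K'. subgroup K' G\<^sub>0 \<and> K' = (\<lambda>k. fst k p) ` K \<and>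
      (\<forall>k\<in>K. \<forall>y. wreath_transport \<psi> \<phi> k p y = \<phi> (fst k p) y) \<and>
      (finitely_generated (?D\<lparr>carrier := K\<rparr>) \<longrightarrow> finitely_generated (G\<^sub>0\<lparr>carrier := K'\<rparr>))"
    if p: "p \<in> P" and K: "subgroup K ?G" and st: "K \<subseteq> stabilizer ?G (\<lambda>\<gamma>. \<psi> (snd \<gamma>)) p" for p K
  proof -
    have K\<Gamma>: "K \<subseteq> \<Gamma>" using subgroup.subset[OF K] by simp
    have kp: "\<psi> (snd k) p = p" if "k \<in> K" for k using st that by (auto simp: stabilizer_def)
    have kp': "\<psi> (inv\<^bsub>H\<^esub> snd k) p = p" if "k \<in> K" for k
    proof -
      have "\<psi> (inv\<^bsub>H\<^esub> snd k) (\<psi> (snd k) p) = p"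
        using comp[of "inv\<^bsub>H\<^esub> snd k" "snd k" p] mem(2)[of k] K\<Gamma> that p group_action_one[OF act p] by auto
      then show ?thesis using kp[OF that] by simp
    qed
    have "group_hom (?G\<lparr>carrier := K\<rparr>) G\<^sub>0 (\<lambda>k. fst k p)"
    proof (intro group_hom.intro group_hom_axioms.intro homI)
      show "group (?G\<lparr>carrier := K\<rparr>)" by (rule subgroup.subgroup_is_group[OF K G.is_group])
      show "fst k p \<in> carrier G\<^sub>0" if "k \<in> carrier (?G\<lparr>carrier := K\<rparr>)" for k
        by (rule fstc) (use that K\<Gamma> p in auto)
      show "fst (k \<otimes>\<^bsub>?G\<lparr>carrier := K\<rparr>\<^esub> l) p = fst k p \<otimes>\<^bsub>G\<^sub>0\<^esub> fst l p"
        if "k \<in> carrier (?G\<lparr>carrier := K\<rparr>)" "l \<in> carrier (?G\<lparr>carrier := K\<rparr>)" for k l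
        using mult[of k l] that p kp'[of k] by simp
    qed (rule G0.is_group)
    then interpret \<pi>: group_hom "?G\<lparr>carrier := K\<rparr>" G\<^sub>0 "\<lambda>k. fst k p" .
    show ?thesis
      using \<pi>.img_is_subgroup \<pi>.finitely_generated_image kp by auto
  qed
  show ?thesis
  proof (intro bundle_action.intro bundle_action_axioms.intro)
    show "group_action ?G P (\<lambda>\<gamma>. \<psi> (snd \<gamma>))" by (rule actP)
    show "x\<^sub>0 \<in> X\<^sub>0" by (rule x\<^sub>0)
    show "wreath_transport \<psi> \<phi> g p y \<in> X\<^sub>0" if "g \<in> carrier ?G" "p \<in> P" "y \<in> X\<^sub>0" for g p y
      using that fstc cl mem(2) cl0 by simp
    show "wreath_transport \<psi> \<phi> \<one>\<^bsub>?G\<^esub> p y = y" if "p \<in> P" "y \<in> X\<^sub>0" for p y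
      unfolding one using that group_action_one[OF act] group_action_one[OF actG] by simp
    show "wreath_transport \<psi> \<phi> (g \<otimes>\<^bsub>?G\<^esub> h) p y
        = wreath_transport \<psi> \<phi> g (\<psi> (snd h) p) (wreath_transport \<psi> \<phi> h p y)"
      if "g \<in> carrier ?G" "h \<in> carrier ?G" "p \<in> P" "y \<in> X\<^sub>0" for g h p y
    proof -
      have c: "snd g \<in> carrier H" "snd h \<in> carrier H" "g \<in> \<Gamma>" "h \<in> \<Gamma>" using that mem(2) by auto
      have q: "\<psi> (snd h) p \<in> P" "\<psi> (snd g) (\<psi> (snd h) p) \<in> P" using c cl that by auto
      have e: "\<psi> (inv\<^bsub>H\<^esub> snd g) (\<psi> (snd g) (\<psi> (snd h) p)) = \<psi> (snd h) p"
        using comp[of "inv\<^bsub>H\<^esub> snd g" "snd g" "\<psi> (snd h) p"] c q group_action_one[OF act] by simp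
      show ?thesis
        unfolding mult using c q e that(3,4) fstc by (simp add: comp comp0)
    qed
    show "finite {p \<in> P. wreath_transport \<psi> \<phi> g p x\<^sub>0 \<noteq> x\<^sub>0}" if "g \<in> carrier ?G" for g
    proof -
      let ?c = "\<lambda>p\<in>P. x\<^sub>0"
      have g: "g \<in> \<Gamma>" using that by simp
      have c: "?c \<in> restricted_power P X\<^sub>0 x\<^sub>0" using x\<^sub>0 by (auto simp: restricted_power_def)
      have "wreath_action H P \<psi> X\<^sub>0 \<phi> g ?c \<in> restricted_power P X\<^sub>0 x\<^sub>0"
        using subgroup.subset[OF \<Gamma>] g c by (auto simp: G_oplus_def)
      then have fin: "finite {p \<in> P. wreath_action H P \<psi> X\<^sub>0 \<phi> g ?c p \<noteq> x\<^sub>0}"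
        by (simp add: restricted_power_def)
      have "\<psi> (snd g) ` {p \<in> P. wreath_transport \<psi> \<phi> g p x\<^sub>0 \<noteq> x\<^sub>0} \<subseteq> {p \<in> P. wreath_action H P \<psi> X\<^sub>0 \<phi> g ?c p \<noteq> x\<^sub>0}"
        using x\<^sub>0 mem(2)[OF g] cl wreath_action_apply[of ?c P X\<^sub>0 _ H \<psi> \<phi> "fst g" "snd g"] by auto
      then have "finite (\<psi> (snd g) ` {p \<in> P. wreath_transport \<psi> \<phi> g p x\<^sub>0 \<noteq> x\<^sub>0})"
        using fin finite_subset by blast
      moreover have "inj_on (\<psi> (snd g)) P"
        using group_action.inj_prop[OF act] mem(2)[OF g] by blast
      ultimately show ?thesis
        by (rule finite_imageD[OF _ inj_on_subset]) auto
    qed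
    show "\<exists>y\<in>X\<^sub>0. \<forall>k\<in>K. wreath_transport \<psi> \<phi> k p y = y"
      if p: "p \<in> P" and K: "subgroup K ?G" "K \<subseteq> stabilizer ?G (\<lambda>\<gamma>. \<psi> (snd \<gamma>)) p" and y: "y \<in> X\<^sub>0"
        and fin: "finite ((\<lambda>k. wreath_transport \<psi> \<phi> k p y) ` K)" for p K y
    proof -
      obtain K' where K': "subgroup K' G\<^sub>0" "K' = (\<lambda>k. fst k p) ` K"
        "\<forall>k\<in>K. \<forall>y. wreath_transport \<psi> \<phi> k p y = \<phi> (fst k p) y"
        using fibre[OF p K] by blast
      have "orbit (G\<^sub>0\<lparr>carrier := K'\<rparr>) \<phi> y = (\<lambda>k. wreath_transport \<psi> \<phi> k p y) ` K"
        using K'(3) by (auto simp: orbit_def K'(2))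
      then have "fixes_point (G\<^sub>0\<lparr>carrier := K'\<rparr>) X\<^sub>0 \<phi>"
        using dec K'(1) fin y unfolding decent_action_def by metis
      then show ?thesis using K'(2,3) by (auto simp: fixes_point_def)
    qed
    show "\<exists>y\<in>X\<^sub>0. \<forall>k\<in>K. wreath_transport \<psi> \<phi> k p y = y"
      if p: "p \<in> P" and K: "subgroup K ?G" "K \<subseteq> stabilizer ?G (\<lambda>\<gamma>. \<psi> (snd \<gamma>)) p"
        and fg: "finitely_generated (?D\<lparr>carrier := \<Gamma>, carrier := K\<rparr>)"
        and ell: "\<forall>k\<in>K. \<exists>y\<in>X\<^sub>0. wreath_transport \<psi> \<phi> k p y = y" for p K
    proof -
      obtain K' where K': "subgroup K' G\<^sub>0" "K' = (\<lambda>k. fst k p) ` K"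
        "\<forall>k\<in>K. \<forall>y. wreath_transport \<psi> \<phi> k p y = \<phi> (fst k p) y"
        "finitely_generated (?D\<lparr>carrier := K\<rparr>) \<longrightarrow> finitely_generated (G\<^sub>0\<lparr>carrier := K'\<rparr>)"
        using fibre[OF p K] by blast
      have "purely_elliptic (G\<^sub>0\<lparr>carrier := K'\<rparr>) X\<^sub>0 \<phi>"
        using ell K'(2,3) by (auto simp: purely_elliptic_def)
      moreover have "finitely_generated (G\<^sub>0\<lparr>carrier := K'\<rparr>)" using K'(4) fg by simp
      ultimately have "fixes_point (G\<^sub>0\<lparr>carrier := K'\<rparr>) X\<^sub>0 \<phi>"
        using dec K'(1) unfolding decent_action_def by metis
      then show ?thesis using K'(2,3) by (auto simp: fixes_point_def)
    qed
  qed
qed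

lemma fixed_iff_invariant:
  assumes actG: "group_action G\<^sub>0 X\<^sub>0 \<phi>" and act: "group_action H P \<psi>"
    and \<gamma>: "\<gamma> \<in> carrier (wreath_product G\<^sub>0 H P \<psi>)" and y: "y \<in> restricted_power P X\<^sub>0 x\<^sub>0"
  shows "G_oplus_action H P \<psi> X\<^sub>0 \<phi> x\<^sub>0 \<gamma> y = y
    \<longleftrightarrow> (\<forall>p\<in>P. y (\<psi> (snd \<gamma>) p) = wreath_transport \<psi> \<phi> \<gamma> p (y p))"
proof -
  interpret H: group H by (rule group_action_group[OF act])
  have h: "snd \<gamma> \<in> carrier H" using \<gamma> by (auto simp: wreath_product_def)
  have yPi: "y \<in> (\<Pi>\<^sub>E p\<in>P. X\<^sub>0)" using y by (simp add: restricted_power_def)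
  let ?z = "wreath_action H P \<psi> X\<^sub>0 \<phi> \<gamma> y"
  have z: "?z q = \<phi> (fst \<gamma> q) (y (\<psi> (inv\<^bsub>H\<^esub> snd \<gamma>) q))" if "q \<in> P" for q
    using wreath_action_apply[OF yPi that, of H \<psi> \<phi> "fst \<gamma>" "snd \<gamma>"] by simp
  have zext: "?z \<in> extensional P" using yPi by (cases \<gamma>) (simp add: wreath_action_def)
  have inv: "\<psi> (inv\<^bsub>H\<^esub> snd \<gamma>) (\<psi> (snd \<gamma>) p) = p" "\<psi> (snd \<gamma>) (\<psi> (inv\<^bsub>H\<^esub> snd \<gamma>) p) = p" if "p \<in> P" for p
    using group_action_comp[OF act, of "inv\<^bsub>H\<^esub> snd \<gamma>" "snd \<gamma>" p]
      group_action_comp[OF act, of "snd \<gamma>" "inv\<^bsub>H\<^esub> snd \<gamma>" p] h that group_action_one[OF act that] by auto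
  have cl: "\<psi> (snd \<gamma>) p \<in> P" "\<psi> (inv\<^bsub>H\<^esub> snd \<gamma>) p \<in> P" if "p \<in> P" for p
    using group_action_closed[OF act] h that by auto
  have "G_oplus_action H P \<psi> X\<^sub>0 \<phi> x\<^sub>0 \<gamma> y = ?z" using y by (simp add: G_oplus_action_def)
  moreover have "?z = y \<longleftrightarrow> (\<forall>q\<in>P. ?z q = y q)"
    using zext yPi by (auto intro!: extensionalityI[of _ P] simp: PiE_iff)
  moreover have "(\<forall>q\<in>P. ?z q = y q) \<longleftrightarrow> (\<forall>p\<in>P. ?z (\<psi> (snd \<gamma>) p) = y (\<psi> (snd \<gamma>) p))"
    using cl inv by metis
  moreover have "?z (\<psi> (snd \<gamma>) p) = wreath_transport \<psi> \<phi> \<gamma> p (y p)" if "p \<in> P" for p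
    using z[OF cl(1)[OF that]] inv(1)[OF that] by simp
  ultimately show ?thesis by (metis (no_types, lifting))
qed

theorem lemma1p6:
  fixes G\<^sub>0 :: "('g, 'm) monoid_scheme" and X\<^sub>0 :: "'x set" and \<phi> :: "'g \<Rightarrow> 'x \<Rightarrow> 'x" and x\<^sub>0 :: 'x
    and H :: "('h, 'n) monoid_scheme" and P :: "'p set" and \<psi> :: "'h \<Rightarrow> 'p \<Rightarrow> 'p"
    and \<Gamma> :: "(('p \<Rightarrow> 'g) \<times> 'h) set"
  assumes "group G\<^sub>0" and "decent_action G\<^sub>0 X\<^sub>0 \<phi>" and "x\<^sub>0 \<in> X\<^sub>0"
    and "group H" and "group_action H P \<psi>"
    and "subgroup \<Gamma> (G_oplus G\<^sub>0 H P \<psi> X\<^sub>0 \<phi> x\<^sub>0)"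
    and "finitely_generated ((G_oplus G\<^sub>0 H P \<psi> X\<^sub>0 \<phi> x\<^sub>0)\<lparr>carrier := \<Gamma>\<rparr>)"
    and "purely_elliptic ((G_oplus G\<^sub>0 H P \<psi> X\<^sub>0 \<phi> x\<^sub>0)\<lparr>carrier := \<Gamma>\<rparr>)
           (restricted_power P X\<^sub>0 x\<^sub>0) (G_oplus_action H P \<psi> X\<^sub>0 \<phi> x\<^sub>0)"
    and "virtually_nilpotent (H\<lparr>carrier := snd ` \<Gamma>\<rparr>)"
  shows "fixes_point ((G_oplus G\<^sub>0 H P \<psi> X\<^sub>0 \<phi> x\<^sub>0)\<lparr>carrier := \<Gamma>\<rparr>)
           (restricted_power P X\<^sub>0 x\<^sub>0) (G_oplus_action H P \<psi> X\<^sub>0 \<phi> x\<^sub>0)"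
proof -
  let ?D = "G_oplus G\<^sub>0 H P \<psi> X\<^sub>0 \<phi> x\<^sub>0" and ?Q = "H\<lparr>carrier := snd ` \<Gamma>\<rparr>"
  let ?G = "?D\<lparr>carrier := \<Gamma>\<rparr>" and ?X = "restricted_power P X\<^sub>0 x\<^sub>0"
  note act = assms(5) and \<Gamma> = assms(6)
  have actG: "group_action G\<^sub>0 X\<^sub>0 \<phi>" using assms(2) by (simp add: decent_action_def)
  interpret B: bundle_action ?G P "\<lambda>\<gamma>. \<psi> (snd \<gamma>)" X\<^sub>0 x\<^sub>0 "wreath_transport \<psi> \<phi>"
    by (rule wreath_bundle_action[OF assms(2,3) act \<Gamma>])
  have \<Gamma>W: "\<gamma> \<in> carrier (wreath_product G\<^sub>0 H P \<psi>)" if "\<gamma> \<in> \<Gamma>" for \<gamma>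
    using subgroup.mem_carrier[OF \<Gamma> that] by (simp add: G_oplus_def)
  have fixed: "G_oplus_action H P \<psi> X\<^sub>0 \<phi> x\<^sub>0 \<gamma> y = y \<longleftrightarrow> B.invariant \<gamma> y"
    if "\<gamma> \<in> \<Gamma>" "y \<in> ?X" for \<gamma> y
    unfolding B.invariant_def by (rule fixed_iff_invariant[OF actG act \<Gamma>W[OF that(1)] that(2)])
  have ell: "\<forall>\<gamma>\<in>carrier ?G. \<exists>y\<in>?X. B.invariant \<gamma> y"
    using assms(8) fixed by (fastforce simp: purely_elliptic_def)
  obtain N c where N: "subgroup N ?Q" "finite (rcosets\<^bsub>?Q\<^esub> N)" and Q: "group ?Q"
    and c: "lower_central (?Q\<lparr>carrier := N\<rparr>) c = {\<one>\<^bsub>?Q\<lparr>carrier := N\<rparr>\<^esub>}"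
    and gN: "group (?Q\<lparr>carrier := N\<rparr>)"
    using assms(9) by (auto simp: virtually_nilpotent_def nilpotent_group_def)
  have snd_mult: "snd (g \<otimes>\<^bsub>?D\<^esub> h) = snd g \<otimes>\<^bsub>H\<^esub> snd h" for g h
    by (cases g; cases h) (simp add: G_oplus_def wreath_product_def)
  interpret p: group_hom ?G ?Q snd
    by (intro group_hom.intro group_hom_axioms.intro homI B.is_group Q) (auto simp: snd_mult)
  \<comment> \<open>The nilpotent group \<open>N\<close> only lives in \<open>H\<close>; its preimage in \<open>\<Gamma>\<close> need not be nilpotent, but it still acts on \<open>P\<close> through \<open>N\<close>.\<close>
  define L where "L = {\<gamma> \<in> carrier ?G. snd \<gamma> \<in> N}"
  have L: "subgroup L ?G" "finite (rcosets\<^bsub>?G\<^esub> L)"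
    unfolding L_def by (rule p.preimage_subgroup[OF N(1)] p.preimage_finite_index[OF N])+
  interpret q: group_hom "?G\<lparr>carrier := L\<rparr>" "?Q\<lparr>carrier := N\<rparr>" snd
    by (intro group_hom.intro group_hom_axioms.intro homI gN subgroup.subgroup_is_group[OF L(1) B.is_group])
       (auto simp: snd_mult L_def)
  have "snd ` carrier (?G\<lparr>carrier := L\<rparr>) = carrier (?Q\<lparr>carrier := N\<rparr>)"
    using subgroup.subset[OF N(1)] by (auto simp: L_def image_iff)
  then have lc: "snd ` lower_central (?G\<lparr>carrier := L\<rparr>) c = {\<one>\<^bsub>H\<^esub>}"
    using q.lower_central_image[of c] c by simp
  have nil: "\<forall>\<gamma>\<in>lower_central (?G\<lparr>carrier := L\<rparr>) c. \<forall>p\<in>P. \<psi> (snd \<gamma>) p = p"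
  proof (intro ballI)
    fix \<gamma> p assume "\<gamma> \<in> lower_central (?G\<lparr>carrier := L\<rparr>) c" "p \<in> P"
    moreover have "snd \<gamma> = \<one>\<^bsub>H\<^esub>" using lc calculation(1) by blast
    ultimately show "\<psi> (snd \<gamma>) p = p" using group_action_one[OF act] by simp
  qed
  obtain x where "x \<in> ?X" "\<forall>\<gamma>\<in>carrier ?G. B.invariant \<gamma> x"
    using B.invariant_section_if_virtually_nilpotent[OF assms(7) ell L nil] by blast
  then show ?thesis using fixed by (auto simp: fixes_point_def)
qed

end
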